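(* Let $S_t=S_0e^{X_t}$, $S_0>0$, where $X$ is a CGMY process under $\mathbb{P}$ with parameters $C,G>0$, $M>1$ and $Y\in(1,2)$, such that $(S_t)$ is a $\mathbb{P}$-martingale. Then the at-the-money implied volatility $\hat\sigma_t(0)$ satisfies $$\lim_{t\to0}\frac{\hat\sigma_t(0)}{t^{1/Y-\frac12}}=\sqrt{2\pi}\;\mathbb{E}^*(Z_+),$$ where $Z$ is, under $\mathbb{P}^*$, a symmetric $Y$-stable random variable with characteristic function $\zeta(u)=\exp\big(-2C\,\Gamma(-Y)\,|\cos(\tfrac12Y\pi)|\,|u|^Y\big)$, and $\mathbb{E}^*$ is expectation under $\mathbb{P}^*$.
   Context: A CGMY process is a pure-jump Lévy process (no Gaussian component) with Lévy density $\nu(x)=Ce^{-Mx}x^{-1-Y}1_{\{x>0\}}+Ce^{Gx}|x|^{-1-Y}1_{\{x<0\}}$; for $Y\ne1$ its characteristic function is $\mathbb{E}e^{iuX_t}=\exp\big[tC\Gamma(-Y)\{(M-iu)^Y+(G+iu)^Y-M^Y-G^Y\}+i\hat b ut\big]$ for some $\hat b\in\mathbb{R}$; here $\hat b$ is fixed by the martingale condition $\mathbb{E}e^{X_t}=1$. Interest rate and dividends are zero. $\hat\sigma_t(0)>0$ is the Black–Scholes implied volatility of the at-the-money call with maturity $t$: the unique solution of $\frac1{S_0}\mathbb{E}(S_t-S_0)_+=\Phi\big(\tfrac12\hat\sigma_t(0)\sqrt t\big)-\Phi\big(-\tfrac12\hat\sigma_t(0)\sqrt t\big)$, with $\Phi$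 the standard normal distribution function. $\mathbb{P}^*$ is the share measure, $\mathbb{P}^*(B)=\mathbb{E}(e^{X_t}1_B)$ for $B\in\mathcal F_t$; only the law of $Z$ matters. $z_+=\max(z,0)$. *)

theory Defs
  imports "HOL-Probability.Probability"
begin

text \<open>
  Processes and filtrations are indexed by real times; only times \<open>t \<ge> 0\<close> are constrained.
\<close>

definition filtration_on :: "'a measure \<Rightarrow> (real \<Rightarrow> 'a measure) \<Rightarrow> bool" where
  "filtration_on P F \<longleftrightarrow>
     (\<forall>t\<ge>0. subalgebra P (F t)) \<and> (\<forall>s\<ge>0. \<forall>t\<ge>s. subalgebra (F t) (F s))"

definition martingale :: "'a measure \<Rightarrow> (real \<Rightarrow> 'a measure) \<Rightarrow> (real \<Rightarrow> 'a \<Rightarrow> real) \<Rightarrow> bool" where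
  "martingale P F S \<longleftrightarrow>
     (\<forall>t\<ge>0. S t \<in> borel_measurable (F t) \<and> integrable P (S t)) \<and>
     (\<forall>s\<ge>0. \<forall>t\<ge>s. AE \<omega> in P. real_cond_exp P (F s) (S t) \<omega> = S s \<omega>)"

definition cadlag :: "(real \<Rightarrow> real) \<Rightarrow> bool" where
  "cadlag f \<longleftrightarrow>
     (\<forall>t\<ge>0. (f \<longlongrightarrow> f t) (at_right t)) \<and> (\<forall>t>0. \<exists>l. (f \<longlongrightarrow> l) (at_left t))"

text \<open>
  Increments after time \<open>s\<close> are independent of \<open>F s\<close>; taking for \<open>F\<close> the natural
  filtration of \<open>X\<close> recovers the definition by independent increments.
\<close>

definition levy_process :: "'a measure \<Rightarrow> (real \<Rightarrow> 'a measure) \<Rightarrow> (real \<Rightarrow> 'a \<Rightarrow> real) \<Rightarrow> bool" where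
  "levy_process P F X \<longleftrightarrow>
     (\<forall>t\<ge>0. X t \<in> borel_measurable (F t)) \<and>
     (AE \<omega> in P. X 0 \<omega> = 0) \<and>
     (\<forall>s\<ge>0. \<forall>t\<ge>s. prob_space.indep_set P (sets (F s))
         (sets (vimage_algebra (space P) (\<lambda>\<omega>. X t \<omega> - X s \<omega>) borel))) \<and>
     (\<forall>s\<ge>0. \<forall>t\<ge>s. distr P borel (\<lambda>\<omega>. X t \<omega> - X s \<omega>) = distr P borel (X (t - s))) \<and>
     (\<forall>t\<ge>0. \<forall>\<epsilon>>0.
        ((\<lambda>s. measure P {\<omega> \<in> space P. \<bar>X s \<omega> - X t \<omega>\<bar> > \<epsilon>}) \<longlongrightarrow> 0) (at t within {0..})) \<and>
     (AE \<omega> in P. cadlag (\<lambda>t. X t \<omega>))"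

definition levy_measure :: "real measure \<Rightarrow> bool" where
  "levy_measure \<nu> \<longleftrightarrow>
     sets \<nu> = sets borel \<and> emeasure \<nu> {0} = 0 \<and> (\<integral>\<^sup>+x. ennreal (min 1 (x\<^sup>2)) \<partial>\<nu>) < \<infinity>"

text \<open>
  The Levy-Khintchine formula with drift \<open>b\<close>, Gaussian variance \<open>a\<close> and Levy measure
  \<open>\<nu>\<close>. The drift is relative to the truncation function \<open>x \<mapsto> x\<close> on \<open>[-1, 1]\<close>.
\<close>

definition levy_triplet ::
  "'a measure \<Rightarrow> (real \<Rightarrow> 'a \<Rightarrow> real) \<Rightarrow> real \<Rightarrow> real \<Rightarrow> real measure \<Rightarrow> bool" where
  "levy_triplet P X b a \<nu> \<longleftrightarrow>
     a \<ge> 0 \<and> levy_measure \<nu> \<and>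
     (\<forall>t\<ge>0. \<forall>u::real. char (distr P borel (X t)) u =
        exp (of_real t * (\<i> * of_real (b * u) - of_real (a * u\<^sup>2 / 2) +
          (CLINT x|\<nu>. iexp (u * x) - 1 - \<i> * of_real (u * x * indicator {-1..1} x)))))"

definition cgmy_density :: "real \<Rightarrow> real \<Rightarrow> real \<Rightarrow> real \<Rightarrow> real \<Rightarrow> real" where
  "cgmy_density C G M Y x =
     (if x > 0 then C * exp (- M * x) * x powr (-1 - Y)
      else if x < 0 then C * exp (G * x) * \<bar>x\<bar> powr (-1 - Y)
      else 0)"

text \<open>
  The parameters \<open>C, G, M, Y\<close> do not fix the drift, which is therefore left unspecified.
  It becomes determined once \<open>exp (X t)\<close> is required to be a martingale.
\<close>

definition cgmy_process ::
  "'a measure \<Rightarrow> (real \<Rightarrow> 'a measure) \<Rightarrow> (real \<Rightarrow> 'a \<Rightarrow> real) \<Rightarrow>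
   real \<Rightarrow> real \<Rightarrow> real \<Rightarrow> real \<Rightarrow> bool" where
  "cgmy_process P F X C G M Y \<longleftrightarrow>
     levy_process P F X \<and>
     (\<exists>b. levy_triplet P X b 0 (density lborel (\<lambda>x. ennreal (cgmy_density C G M Y x))))"

abbreviation std_normal_cdf :: "real \<Rightarrow> real" where
  "std_normal_cdf \<equiv> cdf std_normal_distribution"

text \<open>
  Zero interest rate and dividends, strike \<open>S0\<close>; the argument \<open>S\<close> is the terminal
  value of the stock at maturity \<open>t\<close>.
\<close>

definition atm_implied_vol :: "'a measure \<Rightarrow> real \<Rightarrow> ('a \<Rightarrow> real) \<Rightarrow> real \<Rightarrow> real" where
  "atm_implied_vol P S0 S t =
     (THE \<sigma>. \<sigma> > 0 \<and>
        1 / S0 * (\<integral>\<omega>. max (S \<omega> - S0) 0 \<partial>P) =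
        std_normal_cdf (1/2 * \<sigma> * sqrt t) - std_normal_cdf (- (1/2) * \<sigma> * sqrt t))"

end

theory Submission
  imports Defs
begin

text \<open>
  Since \<open>E exp X\<^sub>t = 1\<close>, the at-the-money call is worth \<open>E |exp X\<^sub>t - 1| / 2\<close>, and
  \<open>||exp x - 1| - |x|| \<le> exp x - 1 - x\<close> shows that replacing it by \<open>E |X\<^sub>t| / 2\<close> costs at most
  \<open>- E X\<^sub>t / 2 = O(t)\<close>, which is negligible against \<open>t powr (1 / Y)\<close> because \<open>Y > 1\<close>. No change to the
  share measure is needed. Tonelli's theorem gives, with \<open>\<phi>\<close> the characteristic function of \<open>X\<^sub>t\<close>,
  \<open>E |X\<^sub>t| = 1 / \<pi> * \<integral> (1 - Re \<phi>(u)) / u\<^sup>2 du\<close>. After the substitution \<open>u = v / h\<close>,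
  \<open>h = t powr (1 / Y)\<close>, the exponent becomes that of a CGMY law with parameters \<open>h G\<close>, \<open>h M\<close> plus a
  vanishing drift, and it converges dominatedly to the symmetric stable exponent. Finally the Black--Scholes
  price as a function of \<open>a = \<sigma> sqrt t\<close> is increasing with derivative \<open>1 / sqrt (2 \<pi>)\<close> at 0.
\<close>

section \<open>Integrals of the compensated cosine\<close>

text \<open>The obstacle is the origin \<open>v = 0\<close>. The integrand carries
  \<open>\<bar>v\<bar> powr (- 2)\<close>, whereas the norm of the exponent is controlled only by a
  multiple of \<open>\<bar>v\<bar> + v\<^sup>2\<close>; that would leave a term of order 1/|v|,
  which is not integrable. Real and imaginary parts are therefore bounded separately: the real part
  is dominated by the stable exponent, of order |v|^Y, and the imaginary part enters 1 - Re exp only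
  through its square, of order v^2. Since Y > 1, the resulting |v|^(Y-2) is integrable at 0. The
  O(t) bound on - E X_t comes from the process: stationary increments make t -> E X_t additive, exp
  x - 1 - x \<ge> 0 makes it nonpositive, and such a function on [0,1] is bounded below by a
  multiple of t. The moment formula is proved in [0, \<infinity>], so that finiteness of E |X_t| is
  a conclusion. The limiting integral is never evaluated: the same formula applied to the law of Z
  expresses E Z_+ through it.\<close>

lemma nn_integral_cmult_real:
  fixes f g :: "'a \<Rightarrow> real"
  assumes "c \<ge> 0" "f \<in> borel_measurable M" "\<And>x. x \<in> space M \<Longrightarrow> g x = c * f x"
  shows "(\<integral>\<^sup>+x. ennreal (g x) \<partial>M) = ennreal c * (\<integral>\<^sup>+x. ennreal (f x) \<partial>M)"
proof -
  have "(\<integral>\<^sup>+x. ennreal (g x) \<partial>M) = (\<integral>\<^sup>+x. ennreal c * ennreal (f x) \<partial>M)"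
    using assms by (intro nn_integral_cong) (simp add: ennreal_mult')
  thus ?thesis using assms by (simp add: nn_integral_cmult)
qed

text \<open>Euler's Gamma integral after the substitution t -> s t. Read from right to left it
  writes a negative power of \<open>s\<close> as a mixture of exponentials, which is how the
  integrals below are reduced to an exchange of integration order.\<close>

lemma nn_integral_powr_exp:
  fixes a s :: real
  assumes "a > 0" "s > 0"
  shows "(\<integral>\<^sup>+t. ennreal (indicator {0<..} t * (t powr (a - 1) * exp (- s * t))) \<partial>lborel)
           = ennreal (Gamma a * s powr (- a))"
proof -
  have "ennreal (Gamma a) = (\<integral>\<^sup>+t. ennreal (indicator {0..} t * t powr (a - 1) / exp t) \<partial>lborel)"
    using Gamma_conv_nn_integral_real[OF assms(1)] by (simp add: mult.commute)
  also have "\<dots> = ennreal s * (\<integral>\<^sup>+t. ennreal (indicator {0..} (s * t) * (s * t) powr (a - 1) / exp (s * t)) \<partial>lborel)"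
    using assms by (subst nn_integral_real_affine[where c=s and t=0]) auto
  also have "(\<integral>\<^sup>+t. ennreal (indicator {0..} (s * t) * (s * t) powr (a - 1) / exp (s * t)) \<partial>lborel)
      = ennreal (s powr (a - 1)) * (\<integral>\<^sup>+t. ennreal (indicator {0<..} t * (t powr (a - 1) * exp (- s * t))) \<partial>lborel)"
  proof (rule nn_integral_cmult_real)
    fix t :: real
    show "indicator {0..} (s * t) * (s * t) powr (a - 1) / exp (s * t) =
        s powr (a - 1) * (indicator {0<..} t * (t powr (a - 1) * exp (- s * t)))"
      using assms
      by (cases "t < 0"; cases "t = 0")
         (auto simp: powr_mult exp_minus divide_inverse indicator_def zero_le_mult_iff)
  qed auto
  also have "ennreal s * (ennreal (s powr (a - 1)) * (\<integral>\<^sup>+t. ennreal (indicator {0<..} t * (t powr (a - 1) * exp (- s * t))) \<partial>lborel)) =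
      ennreal (s powr a) * (\<integral>\<^sup>+t. ennreal (indicator {0<..} t * (t powr (a - 1) * exp (- s * t))) \<partial>lborel)"
    using assms by (simp add: mult.assoc[symmetric] ennreal_mult'[symmetric] powr_mult_base)
  finally have *: "ennreal (Gamma a) = \<dots>" .
  have "ennreal (Gamma a * s powr (-a)) = ennreal (s powr (-a)) * ennreal (Gamma a)"
    using assms by (simp add: ennreal_mult' mult.commute Gamma_real_pos less_imp_le)
  also have "\<dots> = ennreal (s powr (-a) * s powr a) * (\<integral>\<^sup>+t. ennreal (indicator {0<..} t * (t powr (a - 1) * exp (- s * t))) \<partial>lborel)"
    unfolding * by (simp add: ennreal_mult mult.assoc)
  also have "s powr (-a) * s powr a = 1"
    using assms by (simp add: powr_minus)
  finally show ?thesis by simp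
qed

text \<open>At integers both sides are 0, by the conventions for \<open>Gamma\<close> at its poles
  and for division by zero.\<close>

lemma Gamma_reflection_real: "Gamma x * Gamma (1 - x) = pi / sin (pi * x)" for x :: real
proof -
  have "complex_of_real (Gamma x * Gamma (1 - x)) = Gamma (of_real x) * Gamma (1 - of_real x)"
    using Gamma_complex_of_real[of x] Gamma_complex_of_real[of "1 - x"] by simp
  also have "\<dots> = of_real pi / sin (of_real pi * of_real x)"
    by (rule Gamma_reflection_complex)
  also have "\<dots> = complex_of_real (pi / sin (pi * x))"
    using sin_of_real[of "pi * x", where 'a=complex] by simp
  finally show ?thesis using of_real_eq_iff by blast
qed

text \<open>Write 1 / (1 + w) as the integral of exp (- (1 + w) r) over r > 0 and exchange. The
  inner integral over w is \<open>Gamma a * r powr (- a)\<close>, the outer one contributes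
  \<open>Gamma (1 - a)\<close>, and the reflection formula finishes.\<close>

lemma nn_integral_powr_div_one_plus:
  fixes a :: real
  assumes "0 < a" "a < 1"
  shows "(\<integral>\<^sup>+w. ennreal (indicator {0<..} w * (w powr (a - 1) / (1 + w))) \<partial>lborel)
           = ennreal (pi / sin (pi * a))"
proof -
  have "(\<integral>\<^sup>+w. ennreal (indicator {0<..} w * (w powr (a - 1) / (1 + w))) \<partial>lborel) =
     (\<integral>\<^sup>+w. \<integral>\<^sup>+r. ennreal (indicator {0<..} w * w powr (a - 1) * (indicator {0<..} r * exp (- (1 + w) * r))) \<partial>lborel \<partial>lborel)"
  proof (rule nn_integral_cong)
    fix w :: real
    show "ennreal (indicator {0<..} w * (w powr (a - 1) / (1 + w))) =
      (\<integral>\<^sup>+r. ennreal (indicator {0<..} w * w powr (a - 1) * (indicator {0<..} r * exp (- (1 + w) * r))) \<partial>lborel)"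
    proof (cases "w > 0")
      case True
      have "(\<integral>\<^sup>+r. ennreal (indicator {0<..} w * w powr (a - 1) * (indicator {0<..} r * exp (- (1 + w) * r))) \<partial>lborel)
        = ennreal (w powr (a - 1)) * (\<integral>\<^sup>+r. ennreal (indicator {0<..} r * (r powr (1 - 1) * exp (- (1 + w) * r))) \<partial>lborel)"
        using True by (intro nn_integral_cmult_real) auto
      also have "\<dots> = ennreal (w powr (a - 1)) * ennreal (Gamma 1 * (1 + w) powr (- 1))"
        using True by (subst nn_integral_powr_exp) auto
      also have "\<dots> = ennreal (w powr (a - 1) / (1 + w))"
        using True by (simp add: ennreal_mult'[symmetric] powr_minus_divide)
      finally show ?thesis using True by simp
    qed auto
  qed
  also have "\<dots> = (\<integral>\<^sup>+r. \<integral>\<^sup>+w. ennreal (indicator {0<..} w * w powr (a - 1) * (indicator {0<..} r * exp (- (1 + w) * r))) \<partial>lborel \<partial>lborel)"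
    by (rule lborel_pair.Fubini') auto
  also have "\<dots> = (\<integral>\<^sup>+r. ennreal (Gamma a) * ennreal (indicator {0<..} r * (r powr ((1 - a) - 1) * exp (- 1 * r))) \<partial>lborel)"
  proof (rule nn_integral_cong)
    fix r :: real
    show "(\<integral>\<^sup>+w. ennreal (indicator {0<..} w * w powr (a - 1) * (indicator {0<..} r * exp (- (1 + w) * r))) \<partial>lborel)
       = ennreal (Gamma a) * ennreal (indicator {0<..} r * (r powr ((1 - a) - 1) * exp (- 1 * r)))"
    proof (cases "r > 0")
      case True
      have "(\<integral>\<^sup>+w. ennreal (indicator {0<..} w * w powr (a - 1) * (indicator {0<..} r * exp (- (1 + w) * r))) \<partial>lborel)
        = ennreal (exp (- r)) * (\<integral>\<^sup>+w. ennreal (indicator {0<..} w * (w powr (a - 1) * exp (- r * w))) \<partial>lborel)"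
        using True by (intro nn_integral_cmult_real) (auto simp: exp_add[symmetric] algebra_simps split: split_indicator)
      also have "\<dots> = ennreal (exp (-r)) * ennreal (Gamma a * r powr (- a))"
        using True assms by (subst nn_integral_powr_exp) auto
      finally show ?thesis using True assms
        by (simp add: ennreal_mult'[symmetric] Gamma_real_pos less_imp_le mult_ac)
    qed auto
  qed
  also have "\<dots> = ennreal (Gamma a) * ennreal (Gamma (1 - a) * 1 powr (- (1 - a)))"
    using assms by (subst nn_integral_cmult, simp, subst nn_integral_powr_exp) auto
  also have "\<dots> = ennreal (Gamma a * Gamma (1 - a))"
    using assms by (simp add: ennreal_mult'[symmetric] less_imp_le)
  also have "Gamma a * Gamma (1 - a) = pi / sin (pi * a)"
    by (rule Gamma_reflection_real)
  finally show ?thesis .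
qed

text \<open>The substitution w = s^2 reduces this to the previous integral at a / 2. The change of
  variables theorem speaks of absolute integrability and the gauge integral, hence the passage to
  them and back to \<open>lborel\<close>.\<close>

lemma nn_integral_powr_div_one_plus_square:
  fixes a :: real
  assumes "0 < a" "a < 2"
  shows "(\<integral>\<^sup>+s. ennreal (indicator {0<..} s * (s powr (a - 1) / (1 + s\<^sup>2))) \<partial>lborel)
           = ennreal (pi / (2 * sin (pi * a / 2)))"
proof -
  \<comment> \<open>The factor 1 / 2 cancels against the Jacobian \<open>\<bar>2 * x\<bar>\<close>
    of squaring.\<close>
  define f where "f w = 1 / 2 * (w powr (a / 2 - 1) / (1 + w))" for w :: real
  have pos: "pi / sin (pi * (a / 2)) > 0"
    using assms by (intro divide_pos_pos pi_gt_zero sin_gt_zero) auto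
  have "(\<integral>\<^sup>+w. ennreal (indicator {0<..} w * f w) \<partial>lborel)
      = ennreal (1/2) * (\<integral>\<^sup>+w. ennreal (indicator {0<..} w * (w powr (a / 2 - 1) / (1 + w))) \<partial>lborel)"
    by (intro nn_integral_cmult_real) (auto simp: f_def)
  also have "\<dots> = ennreal (1/2) * ennreal (pi / sin (pi * (a / 2)))"
    using assms by (subst nn_integral_powr_div_one_plus) auto
  also have "\<dots> = ennreal (pi / (2 * sin (pi * a / 2)))"
    using pos by (subst ennreal_mult'[symmetric]) (auto)
  finally have nn: "(\<integral>\<^sup>+w. ennreal (indicator {0<..} w * f w) \<partial>lborel) = ennreal (pi / (2 * sin (pi * a / 2)))" .
  have f0: "0 \<le> indicator {0<..} w * f w" for w by (auto simp: f_def split: split_indicator)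
  have fm: "(\<lambda>w. indicator {0<..} w * f w) \<in> borel_measurable borel" unfolding f_def by measurable
  have hb: "has_bochner_integral lborel (\<lambda>w. indicator {0<..} w * f w) (pi / (2 * sin (pi * a / 2)))"
    using nn pos f0 fm by (intro has_bochner_integral_nn_integral) auto
  have ai: "f absolutely_integrable_on {0<..}"
    using hb unfolding set_integrable_def has_bochner_integral_iff
    by (auto intro: integrable_completion[THEN iffD2] simp: fm)
  have iv: "integral {0<..} f = pi / (2 * sin (pi * a / 2))"
    using hb ai fm by (simp add: set_lebesgue_integral_eq_integral(2)[symmetric] set_lebesgue_integral_def
       has_bochner_integral_iff integral_completion)
  have im: "(\<lambda>x::real. x\<^sup>2) ` {0<..} = {0<..}"
  proof (intro equalityI subsetI)
    fix x :: real assume "x \<in> {0<..}"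
    thus "x \<in> (\<lambda>x::real. x\<^sup>2) ` {0<..}" by (intro image_eqI[of _ _ "sqrt x"]) auto
  qed auto
  have cv: "(\<lambda>x. \<bar>2 * x\<bar> * f (x\<^sup>2)) absolutely_integrable_on {0<..} \<and>
     integral {0<..} (\<lambda>x. \<bar>2 * x\<bar> * f (x\<^sup>2)) = pi / (2 * sin (pi * a / 2))"
    by (subst has_absolute_integral_change_of_variables_1'[where g="\<lambda>x. x\<^sup>2"])
       (use ai iv im in \<open>auto intro!: derivative_eq_intros inj_onI\<close>)
  define g where "g s = s powr (a - 1) / (1 + s\<^sup>2)" for s :: real
  have eq: "\<bar>2 * x\<bar> * f (x\<^sup>2) = g x" if "x \<in> {0<..}" for x
  proof -
    have "(x\<^sup>2) powr (a / 2 - 1) = x powr (a - 2)"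
      using that by (simp add: powr_powr flip: powr_numeral)
    moreover have "x powr (a - 1) = x * x powr (a - 2)"
      using that by (simp add: powr_mult_base)
    ultimately show ?thesis using that by (simp add: f_def g_def del: distrib_left_numeral)
  qed
  have ai': "g absolutely_integrable_on {0<..}"
    using cv eq by (metis (no_types, lifting) set_integrable_cong)
  have iv': "integral {0<..} g = pi / (2 * sin (pi * a / 2))"
    using cv eq by (metis (no_types, lifting) Henstock_Kurzweil_Integration.integral_cong)
  have gm: "(\<lambda>w. indicator {0<..} w * g w) \<in> borel_measurable borel" unfolding g_def by measurable
  have "integrable lborel (\<lambda>w. indicator {0<..} w * g w)"
    using ai' gm by (auto simp: set_integrable_def integrable_completion)
  moreover have "(\<integral>w. indicator {0<..} w * g w \<partial>lborel) = pi / (2 * sin (pi * a / 2))"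
    using iv' ai' gm by (simp add: set_lebesgue_integral_eq_integral(2)[symmetric] set_lebesgue_integral_def
       integral_completion)
  ultimately show ?thesis
    using nn_integral_eq_integral[of lborel "\<lambda>w. indicator {0<..} w * g w"]
    by (simp add: g_def split: split_indicator)
qed

text \<open>The Laplace transform of 1 - cos, namely 1/s - s / (1 + s^2), obtained from an explicit
  antiderivative.\<close>

lemma nn_integral_one_minus_cos_exp:
  fixes s :: real
  assumes "s > 0"
  shows "(\<integral>\<^sup>+y. ennreal (indicator {0<..} y * ((1 - cos y) * exp (- s * y))) \<partial>lborel)
           = ennreal (1 / (s * (1 + s\<^sup>2)))"
proof -
  \<comment> \<open>The two terms are antiderivatives of exp (- s y) and of - cos y exp (- s
    y).\<close>
  define F where "F y = - exp (- s * y) / s - exp (- s * y) * (sin y - s * cos y) / (1 + s\<^sup>2)" for y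
  have s0: "1 + s\<^sup>2 > 0" "1 + s\<^sup>2 \<noteq> 0" by (auto intro: add_pos_nonneg simp: add_nonneg_eq_0_iff)
  have D: "(F has_real_derivative (1 - cos y) * exp (- s * y)) (at y)" for y
  proof -
    have "(F has_real_derivative (- (- s * exp (- s * y)) / s -
        (- s * exp (- s * y) * (sin y - s * cos y) + (cos y + s * sin y) * exp (- s * y)) / (1 + s\<^sup>2))) (at y)"
      unfolding F_def using assms s0 by (auto intro!: derivative_eq_intros)
    also have "- s * exp (- s * y) * (sin y - s * cos y) + (cos y + s * sin y) * exp (- s * y) =
        (1 + s\<^sup>2) * (cos y * exp (- s * y))"
      by (simp add: algebra_simps power2_eq_square)
    finally show ?thesis using assms s0 by (simp add: left_diff_distrib)
  qed
  have e: "((\<lambda>y. exp (- s * y)) \<longlongrightarrow> 0) at_top"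
    using assms by (intro filterlim_compose[OF exp_at_bot] filterlim_tendsto_neg_mult_at_bot[OF tendsto_const] filterlim_ident) auto
  have l: "((\<lambda>y. exp (- s * y) * (sin y - s * cos y)) \<longlongrightarrow> 0) at_top"
  proof (rule Lim_null_comparison)
    show "\<forall>\<^sub>F y in at_top. norm (exp (- s * y) * (sin y - s * cos y)) \<le> exp (- s * y) * (1 + s)"
    proof (intro always_eventually allI)
      fix y
      have "\<bar>sin y - s * cos y\<bar> \<le> \<bar>sin y\<bar> + s * \<bar>cos y\<bar>" using assms
        by (metis abs_mult abs_of_pos abs_triangle_ineq4)
      also have "\<dots> \<le> 1 + s * 1" using assms by (intro add_mono mult_left_mono) auto
      finally show "norm (exp (- s * y) * (sin y - s * cos y)) \<le> exp (- s * y) * (1 + s)"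
        by (simp add: abs_mult)
    qed
    show "((\<lambda>y. exp (- s * y) * (1 + s)) \<longlongrightarrow> 0) at_top"
      using tendsto_mult_left_zero[OF e] .
  qed
  have lim: "(F \<longlongrightarrow> - 0 / s - 0 / (1 + s\<^sup>2)) at_top"
    unfolding F_def using s0 assms by (intro tendsto_intros e l) auto
  have "(\<integral>\<^sup>+y. ennreal ((1 - cos y) * exp (- s * y)) * indicator {0..} y \<partial>lborel) = ennreal (0 - F 0)"
    by (rule nn_integral_FTC_atLeast) (use D lim in auto)
  also have "0 - F 0 = 1 / (s * (1 + s\<^sup>2))"
    using assms s0 by (simp add: F_def divide_simps) (simp add: algebra_simps power2_eq_square)
  also have "(\<integral>\<^sup>+y. ennreal ((1 - cos y) * exp (- s * y)) * indicator {0..} y \<partial>lborel) =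
     (\<integral>\<^sup>+y. ennreal (indicator {0<..} y * ((1 - cos y) * exp (- s * y))) \<partial>lborel)"
    by (intro nn_integral_cong) (auto split: split_indicator simp: less_le)
  finally show ?thesis .
qed

text \<open>By Euler's integral, y^(-1-Y) is 1 / \<open>Gamma (1 + Y)\<close> times the integral of
  s^Y exp (- y s) over s > 0. After the exchange, the inner integral over y is the Laplace transform
  of 1 - cos, and s^(Y-1) / (1 + s^2) remains.\<close>

lemma nn_integral_one_minus_cos_powr_half:
  fixes Y :: real
  assumes "0 < Y" "Y < 2"
  shows "(\<integral>\<^sup>+y. ennreal (indicator {0<..} y * ((1 - cos y) * y powr (- 1 - Y))) \<partial>lborel)
           = ennreal (pi / (2 * sin (pi * Y / 2) * Gamma (1 + Y)))"
proof -
  have G: "Gamma (1 + Y) > 0" using assms by auto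
  have "(\<integral>\<^sup>+y. ennreal (indicator {0<..} y * ((1 - cos y) * y powr (- 1 - Y))) \<partial>lborel) =
     (\<integral>\<^sup>+y. \<integral>\<^sup>+s. ennreal (indicator {0<..} y * (1 - cos y) / Gamma (1 + Y) * (indicator {0<..} s * (s powr Y * exp (- y * s)))) \<partial>lborel \<partial>lborel)"
  proof (rule nn_integral_cong)
    fix y :: real
    show "ennreal (indicator {0<..} y * ((1 - cos y) * y powr (- 1 - Y))) =
      (\<integral>\<^sup>+s. ennreal (indicator {0<..} y * (1 - cos y) / Gamma (1 + Y) * (indicator {0<..} s * (s powr Y * exp (- y * s)))) \<partial>lborel)"
    proof (cases "y > 0")
      case True
      have "(\<integral>\<^sup>+s. ennreal (indicator {0<..} y * (1 - cos y) / Gamma (1 + Y) * (indicator {0<..} s * (s powr Y * exp (- y * s)))) \<partial>lborel)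
        = ennreal ((1 - cos y) / Gamma (1 + Y)) * (\<integral>\<^sup>+s. ennreal (indicator {0<..} s * (s powr ((1 + Y) - 1) * exp (- y * s))) \<partial>lborel)"
        using True G by (intro nn_integral_cmult_real) auto
      also have "\<dots> = ennreal ((1 - cos y) / Gamma (1 + Y)) * ennreal (Gamma (1 + Y) * y powr (- (1 + Y)))"
        using True assms by (subst nn_integral_powr_exp) auto
      also have "\<dots> = ennreal ((1 - cos y) * y powr (- 1 - Y))"
        using G by (subst ennreal_mult'[symmetric]) auto
      finally show ?thesis using True by simp
    qed auto
  qed
  also have "\<dots> = (\<integral>\<^sup>+s. \<integral>\<^sup>+y. ennreal (indicator {0<..} y * (1 - cos y) / Gamma (1 + Y) * (indicator {0<..} s * (s powr Y * exp (- y * s)))) \<partial>lborel \<partial>lborel)"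
    by (rule lborel_pair.Fubini') auto
  also have "\<dots> = (\<integral>\<^sup>+s. ennreal (1 / Gamma (1 + Y)) * ennreal (indicator {0<..} s * (s powr (Y - 1) / (1 + s\<^sup>2))) \<partial>lborel)"
  proof (rule nn_integral_cong)
    fix s :: real
    show "(\<integral>\<^sup>+y. ennreal (indicator {0<..} y * (1 - cos y) / Gamma (1 + Y) * (indicator {0<..} s * (s powr Y * exp (- y * s)))) \<partial>lborel)
       = ennreal (1 / Gamma (1 + Y)) * ennreal (indicator {0<..} s * (s powr (Y - 1) / (1 + s\<^sup>2)))"
    proof (cases "s > 0")
      case True
      have "(\<integral>\<^sup>+y. ennreal (indicator {0<..} y * (1 - cos y) / Gamma (1 + Y) * (indicator {0<..} s * (s powr Y * exp (- y * s)))) \<partial>lborel)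
        = ennreal (s powr Y / Gamma (1 + Y)) * (\<integral>\<^sup>+y. ennreal (indicator {0<..} y * ((1 - cos y) * exp (- s * y))) \<partial>lborel)"
        using True G by (intro nn_integral_cmult_real) (auto simp: mult_ac)
      also have "\<dots> = ennreal (s powr Y / Gamma (1 + Y)) * ennreal (1 / (s * (1 + s\<^sup>2)))"
        using True by (subst nn_integral_one_minus_cos_exp) auto
      also have "\<dots> = ennreal (1 / Gamma (1 + Y)) * ennreal (s powr (Y - 1) / (1 + s\<^sup>2))"
        using True G by (subst (1 2) ennreal_mult'[symmetric]) (auto simp: powr_diff field_simps)
      finally show ?thesis using True by simp
    qed auto
  qed
  also have "\<dots> = ennreal (1 / Gamma (1 + Y)) * ennreal (pi / (2 * sin (pi * Y / 2)))"
    using assms by (subst nn_integral_cmult, simp, subst nn_integral_powr_div_one_plus_square) auto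
  also have "\<dots> = ennreal (pi / (2 * sin (pi * Y / 2) * Gamma (1 + Y)))"
    using G by (subst ennreal_mult'[symmetric]) (auto simp: field_simps)
  finally show ?thesis .
qed

section \<open>Integrals over the whole line and the first absolute moment\<close>

lemma nn_integral_lborel_even:
  fixes f :: "real \<Rightarrow> ennreal"
  assumes [measurable]: "f \<in> borel_measurable borel" and even: "\<And>x. f (- x) = f x"
  shows "(\<integral>\<^sup>+x. f x \<partial>lborel) = 2 * (\<integral>\<^sup>+x. indicator {0<..} x * f x \<partial>lborel)"
proof -
  have "(\<integral>\<^sup>+x. f x \<partial>lborel) = (\<integral>\<^sup>+x. indicator {0<..} x * f x + indicator {..<0} x * f x \<partial>lborel)"
    using AE_lborel_singleton[of "0::real"]
    by (intro nn_integral_cong_AE) (auto elim!: eventually_mono split: split_indicator)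
  also have "\<dots> = (\<integral>\<^sup>+x. indicator {0<..} x * f x \<partial>lborel) + (\<integral>\<^sup>+x. indicator {..<0} x * f x \<partial>lborel)"
    by (rule nn_integral_add) auto
  also have "(\<integral>\<^sup>+x. indicator {..<0} x * f x \<partial>lborel) = (\<integral>\<^sup>+x. indicator {0<..} x * f x \<partial>lborel)"
    by (subst nn_integral_real_affine[where c="-1" and t=0])
       (auto simp: even intro!: nn_integral_cong split: split_indicator)
  finally show ?thesis by (simp add: mult_2)
qed

text \<open>The integral of (1 - cos y) |y|^(-1-Y) over the line for 0 < Y < 2. In this form it is
  also meaningful at Y = 1, where \<open>Gamma (- Y)\<close> has a pole; that case, with value pi,
  gives the formula for the absolute moment.\<close>

definition stable_const :: "real \<Rightarrow> real" where
  "stable_const Y = pi / (sin (pi * Y / 2) * Gamma (1 + Y))"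

lemma stable_const_pos:
  assumes "0 < Y" "Y < 2"
  shows "stable_const Y > 0"
proof -
  have "sin (pi * Y / 2) > 0" using assms by (intro sin_gt_zero) auto
  thus ?thesis using assms by (simp add: stable_const_def)
qed

lemma nn_integral_one_minus_cos_powr:
  fixes Y v :: real
  assumes "0 < Y" "Y < 2"
  shows "(\<integral>\<^sup>+y. ennreal ((1 - cos (v * y)) * \<bar>y\<bar> powr (- 1 - Y)) \<partial>lborel)
           = ennreal (\<bar>v\<bar> powr Y * stable_const Y)"
proof (cases "v = 0")
  case False
  define f where "f y = (1 - cos y) * \<bar>y\<bar> powr (- 1 - Y)" for y :: real
  have f[measurable]: "f \<in> borel_measurable borel" unfolding f_def by measurable
  have "(\<integral>\<^sup>+y. ennreal (f y) \<partial>lborel) = 2 * (\<integral>\<^sup>+y. indicator {0<..} y * ennreal (f y) \<partial>lborel)"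
    by (rule nn_integral_lborel_even) (auto simp: f_def)
  also have "(\<integral>\<^sup>+y. indicator {0<..} y * ennreal (f y) \<partial>lborel) = (\<integral>\<^sup>+y. ennreal (indicator {0<..} y * ((1 - cos y) * y powr (- 1 - Y))) \<partial>lborel)"
    by (intro nn_integral_cong) (auto simp: f_def split: split_indicator)
  also have "\<dots> = ennreal (pi / (2 * sin (pi * Y / 2) * Gamma (1 + Y)))"
    by (rule nn_integral_one_minus_cos_powr_half[OF assms])
  also have "pi / (2 * sin (pi * Y / 2) * Gamma (1 + Y)) = stable_const Y / 2"
    by (simp add: stable_const_def)
  also have "2 * ennreal (stable_const Y / 2) = ennreal (stable_const Y)"
    using stable_const_pos[OF assms] by (simp add: ennreal_mult'[symmetric] flip: ennreal_numeral)
  finally have I: "(\<integral>\<^sup>+y. ennreal (f y) \<partial>lborel) = \<dots>" .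
  have "(\<integral>\<^sup>+y. ennreal ((1 - cos (v * y)) * \<bar>y\<bar> powr (- 1 - Y)) \<partial>lborel)
      = ennreal (\<bar>v\<bar> powr (1 + Y)) * (\<integral>\<^sup>+y. ennreal (f (0 + v * y)) \<partial>lborel)"
  proof (rule nn_integral_cmult_real)
    fix y :: real
    have "\<bar>v\<bar> powr (1 + Y) * \<bar>v\<bar> powr (- 1 - Y) = 1"
      using False by (simp add: powr_add[symmetric])
    thus "(1 - cos (v * y)) * \<bar>y\<bar> powr (- 1 - Y) = \<bar>v\<bar> powr (1 + Y) * f (0 + v * y)"
      using False by (simp add: f_def abs_mult powr_mult)
  qed auto
  \<comment> \<open>The split-off factor \<open>\<bar>v\<bar>\<close> is the Jacobian of y -> v
    y.\<close>
  also have "\<bar>v\<bar> powr (1 + Y) = \<bar>v\<bar> powr Y * \<bar>v\<bar>"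
    using False by (simp add: powr_add)
  also have "ennreal \<dots> * (\<integral>\<^sup>+y. ennreal (f (0 + v * y)) \<partial>lborel) = ennreal (\<bar>v\<bar> powr Y) * (\<integral>\<^sup>+y. ennreal (f y) \<partial>lborel)"
    using False by (subst (2) nn_integral_real_affine[where c=v and t=0]) (auto simp: ennreal_mult' mult.assoc)
  finally show ?thesis by (simp add: I ennreal_mult'[symmetric])
qed auto

text \<open>The common shape of the majorants used below: one power governs the origin, the other
  the tails. On the half-line it is bounded by the sum of two explicitly integrable pieces.\<close>

lemma integrable_powr_split:
  fixes a b :: real
  assumes "a > -1" "b < -1"
  shows "integrable lborel (\<lambda>y. if \<bar>y\<bar> \<le> 1 then \<bar>y\<bar> powr a else \<bar>y\<bar> powr b)"
proof -
  define g where "g y = (if \<bar>y\<bar> \<le> 1 then \<bar>y\<bar> powr a else \<bar>y\<bar> powr b)" for y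
  define f1 where "f1 x = (if x \<in> {0..1} then x powr a else 0)" for x :: real
  define f2 where "f2 x = (if x \<in> {1..} then x powr b else 0)" for x :: real
  have [measurable]: "g \<in> borel_measurable borel" "f1 \<in> borel_measurable borel" "f2 \<in> borel_measurable borel"
    unfolding g_def f1_def f2_def by measurable
  have 1: "(\<integral>\<^sup>+x. ennreal (f1 x) \<partial>lborel) = ennreal (1 powr (a + 1) / (a + 1))"
  proof (rule nn_integral_has_integral_lborel)
    show "(f1 has_integral 1 powr (a + 1) / (a + 1)) UNIV"
      unfolding f1_def[abs_def] has_integral_restrict_UNIV
      using has_integral_powr_from_0[OF assms(1), of 1] by simp
  qed (auto simp: f1_def)
  have 2: "(\<integral>\<^sup>+x. ennreal (f2 x) \<partial>lborel) = ennreal (- (1 powr (b + 1)) / (b + 1))"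
  proof (rule nn_integral_has_integral_lborel)
    show "(f2 has_integral - (1 powr (b + 1)) / (b + 1)) UNIV"
      unfolding f2_def[abs_def] has_integral_restrict_UNIV
      using has_integral_powr_to_inf[OF assms(2), of 1] by simp
  qed (auto simp: f2_def)
  have "(\<integral>\<^sup>+x. ennreal (g x) \<partial>lborel) = 2 * (\<integral>\<^sup>+x. indicator {0<..} x * ennreal (g x) \<partial>lborel)"
    by (rule nn_integral_lborel_even) (auto simp: g_def)
  also have "(\<integral>\<^sup>+x. indicator {0<..} x * ennreal (g x) \<partial>lborel) \<le> (\<integral>\<^sup>+x. ennreal (f1 x) + ennreal (f2 x) \<partial>lborel)"
    by (intro nn_integral_mono) (auto simp: g_def f1_def f2_def split: split_indicator)
  also have "\<dots> = ennreal (1 powr (a + 1) / (a + 1)) + ennreal (- (1 powr (b + 1)) / (b + 1))"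
    by (subst nn_integral_add) (simp_all add: 1 2)
  also have "2 * \<dots> < \<infinity>" by (simp add: ennreal_mult_less_top)
  finally have "(\<integral>\<^sup>+x. ennreal (g x) \<partial>lborel) < \<infinity>" by (simp add: mult_left_mono)
  hence "integrable lborel g"
    by (intro integrableI_nonneg) (auto simp: g_def)
  thus ?thesis unfolding g_def .
qed

text \<open>The case Y = 1 of the cosine integral says that |x| is 1 / pi times the integral of (1 -
  cos (x u)) / u^2 over u; integrate this against the law and exchange. Both sides may be infinite,
  so the identity can later serve to prove integrability.\<close>

lemma (in real_distribution) nn_integral_abs_char:
  "(\<integral>\<^sup>+x. ennreal \<bar>x\<bar> \<partial>M)
     = ennreal (1 / pi) * (\<integral>\<^sup>+u. ennreal ((1 - Re (char M u)) * \<bar>u\<bar> powr (- 2)) \<partial>lborel)"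
proof -
  interpret pair_sigma_finite lborel M
    by (simp add: pair_sigma_finite_def sigma_finite_measure_axioms lborel.sigma_finite_measure_axioms)
  have "(\<integral>\<^sup>+u. ennreal ((1 - Re (char M u)) * \<bar>u\<bar> powr (- 2)) \<partial>lborel)
      = (\<integral>\<^sup>+u. \<integral>\<^sup>+x. ennreal ((1 - cos (x * u)) * \<bar>u\<bar> powr (- 2)) \<partial>M \<partial>lborel)"
  proof (rule nn_integral_cong)
    fix u :: real
    have i: "integrable M (\<lambda>x. cos (x * u))"
      by (rule integrable_const_bound[where B=1]) auto
    have "Re (char M u) = (\<integral>x. Re (iexp (u * x)) \<partial>M)"
      unfolding char_def by (subst integral_Re) (auto intro: integrable_iexp)
    also have "\<dots> = (\<integral>x. cos (x * u) \<partial>M)"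
      by (simp add: Re_exp mult.commute)
    finally have "(1 - Re (char M u)) * \<bar>u\<bar> powr (- 2) = (\<integral>x. (1 - cos (x * u)) * \<bar>u\<bar> powr (- 2) \<partial>M)"
      using i prob_space by simp
    thus "ennreal ((1 - Re (char M u)) * \<bar>u\<bar> powr (- 2)) = (\<integral>\<^sup>+x. ennreal ((1 - cos (x * u)) * \<bar>u\<bar> powr (- 2)) \<partial>M)"
      using i by (subst nn_integral_eq_integral) auto
  qed
  also have "\<dots> = (\<integral>\<^sup>+x. \<integral>\<^sup>+u. ennreal ((1 - cos (x * u)) * \<bar>u\<bar> powr (- 2)) \<partial>lborel \<partial>M)"
    by (rule Fubini'[symmetric]) auto
  also have "\<dots> = (\<integral>\<^sup>+x. ennreal pi * ennreal \<bar>x\<bar> \<partial>M)"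
  proof (rule nn_integral_cong)
    fix x :: real
    have "Gamma 2 = (1 :: real)" using Gamma_fact[of 1, where 'a=real] by simp
    thus "(\<integral>\<^sup>+u. ennreal ((1 - cos (x * u)) * \<bar>u\<bar> powr (- 2)) \<partial>lborel) = ennreal pi * ennreal \<bar>x\<bar>"
      using nn_integral_one_minus_cos_powr[of 1 x]
      by (simp add: stable_const_def ennreal_mult'[symmetric] mult.commute)
  qed
  also have "\<dots> = ennreal pi * (\<integral>\<^sup>+x. ennreal \<bar>x\<bar> \<partial>M)"
    by (rule nn_integral_cmult) auto
  finally show ?thesis
    by (simp add: mult.assoc[symmetric] ennreal_mult'[symmetric])
qed

section \<open>The tempered stable exponent\<close>

lemma cgmy_density_measurable [measurable]: "cgmy_density C G M Y \<in> borel_measurable borel"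
  unfolding cgmy_density_def[abs_def] by measurable

lemma cgmy_density_nonneg: "C \<ge> 0 \<Longrightarrow> cgmy_density C G M Y x \<ge> 0"
  by (simp add: cgmy_density_def)

lemma cgmy_density_le:
  assumes "C \<ge> 0" "G \<ge> 0" "M \<ge> 0"
  shows "cgmy_density C G M Y x \<le> C * \<bar>x\<bar> powr (- 1 - Y)"
proof -
  have "C * exp z * \<bar>x\<bar> powr (- 1 - Y) \<le> C * \<bar>x\<bar> powr (- 1 - Y)" if "z \<le> 0" for z
    using that assms by (intro mult_right_mono mult_left_le) auto
  thus ?thesis using assms by (auto simp: cgmy_density_def mult_nonneg_nonpos)
qed

text \<open>The power is homogeneous of degree -1 - Y, and in the exponential the factor
  \<open>h\<close> can be moved from the jump size to the tempering parameters.\<close>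

lemma cgmy_density_mult:
  assumes "h > 0"
  shows "cgmy_density C G M Y (h * x) = h powr (- 1 - Y) * cgmy_density C (h * G) (h * M) Y x"
proof (cases "x < 0")
  case True
  have "(- (h * x)) powr (- 1 - Y) = h powr (- 1 - Y) * (- x) powr (- 1 - Y)"
    using True assms powr_mult[of h "- x" "- 1 - Y"] by simp
  moreover have "\<bar>h * x\<bar> = - (h * x)"
    using True assms by (simp add: abs_mult)
  ultimately show ?thesis
    using True assms by (simp add: cgmy_density_def zero_less_mult_iff mult_less_0_iff mult_ac)
qed (use assms in \<open>auto simp: cgmy_density_def zero_less_mult_iff mult_less_0_iff powr_mult mult_ac\<close>)

lemma tendsto_cgmy_density:
  "((\<lambda>h. cgmy_density C (h * G) (h * M) Y x) \<longlongrightarrow> C * \<bar>x\<bar> powr (- 1 - Y)) (at_right 0)"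
proof -
  have "((\<lambda>h. C * exp (- (h * M) * x) * \<bar>x\<bar> powr (- 1 - Y)) \<longlongrightarrow> C * exp (- (0 * M) * x) * \<bar>x\<bar> powr (- 1 - Y)) (at_right 0)"
       "((\<lambda>h. C * exp ((h * G) * x) * \<bar>x\<bar> powr (- 1 - Y)) \<longlongrightarrow> C * exp ((0 * G) * x) * \<bar>x\<bar> powr (- 1 - Y)) (at_right 0)"
    by (intro tendsto_intros)+
  thus ?thesis by (cases "x > 0"; cases "x < 0") (auto simp: cgmy_density_def)
qed

text \<open>The Taylor remainder of order one is at most (v y)^2 / 2, which serves small jumps, and
  at most 2 |v y|, which serves large ones. The single constant
  \<open>2 * (\<bar>v\<bar> + v\<^sup>2)\<close> covers both regimes.\<close>

lemma norm_iexp_compensated_le: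
  fixes v y Y :: real
  shows "norm (iexp (v * y) - 1 - \<i> * of_real (v * y)) * \<bar>y\<bar> powr (- 1 - Y)
      \<le> 2 * (\<bar>v\<bar> + v\<^sup>2) * (if \<bar>y\<bar> \<le> 1 then \<bar>y\<bar> powr (1 - Y) else \<bar>y\<bar> powr (- Y))"
proof (cases "y = 0")
  case False
  have e: "iexp (v * y) - 1 - \<i> * of_real (v * y)
      = iexp (v * y) - (\<Sum>k\<le>1. (\<i> * of_real (v * y)) ^ k / fact k)"
    by simp
  \<comment> \<open>The bracket equals \<open>2 * (\<bar>v\<bar> + v\<^sup>2)\<close>, written so
    that the summand actually obtained is visible.\<close>
  have 1: "norm (iexp (v * y) - 1 - \<i> * of_real (v * y)) \<le> (v\<^sup>2 + (\<bar>v\<bar> + v\<^sup>2 + \<bar>v\<bar>)) * \<bar>y\<bar>\<^sup>2"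
  proof -
    have "norm (iexp (v * y) - 1 - \<i> * of_real (v * y)) \<le> \<bar>v * y\<bar> ^ Suc 1 / fact (Suc 1)"
      unfolding e by (rule iexp_approx1)
    also have "\<dots> = v\<^sup>2 * y\<^sup>2 / 2"
      by (simp add: power2_eq_square)
    finally have "norm (iexp (v * y) - 1 - \<i> * of_real (v * y)) \<le> v\<^sup>2 * y\<^sup>2 / 2" .
    hence "norm (iexp (v * y) - 1 - \<i> * of_real (v * y)) \<le> v\<^sup>2 * y\<^sup>2" by (rule order_trans) simp
    also have "\<dots> \<le> (v\<^sup>2 + (\<bar>v\<bar> + v\<^sup>2 + \<bar>v\<bar>)) * \<bar>y\<bar>\<^sup>2"
      by (simp add: mult_right_mono)
    finally show ?thesis .
  qed
  have 2: "norm (iexp (v * y) - 1 - \<i> * of_real (v * y)) \<le> 2 * (\<bar>v\<bar> + v\<^sup>2) * \<bar>y\<bar>"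
  proof -
    have "norm (iexp (v * y) - 1 - \<i> * of_real (v * y)) \<le> 2 * (\<bar>v\<bar> * \<bar>y\<bar>)"
      unfolding e using iexp_approx2[of "v * y" 1] by (simp add: abs_mult)
    also have "\<dots> \<le> 2 * ((\<bar>v\<bar> + v\<^sup>2) * \<bar>y\<bar>)"
      by (intro mult_left_mono mult_right_mono) auto
    finally show ?thesis by (simp only: mult.assoc)
  qed
  have p2: "\<bar>y\<bar>\<^sup>2 * \<bar>y\<bar> powr (- 1 - Y) = \<bar>y\<bar> powr (1 - Y)"
  proof -
    have "\<bar>y\<bar>\<^sup>2 * \<bar>y\<bar> powr (- 1 - Y) = \<bar>y\<bar> powr 2 * \<bar>y\<bar> powr (- 1 - Y)" using False by simp
    thus ?thesis using False by (simp only: powr_add[symmetric]) simp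
  qed
  have p1: "\<bar>y\<bar> * \<bar>y\<bar> powr (- 1 - Y) = \<bar>y\<bar> powr (- Y)"
    using False by (simp add: powr_mult_base)
  show ?thesis
    using mult_right_mono[OF 1, of "\<bar>y\<bar> powr (- 1 - Y)"] mult_right_mono[OF 2, of "\<bar>y\<bar> powr (- 1 - Y)"] p1 p2
    by (simp add: mult.assoc) (simp add: algebra_simps)
qed auto

text \<open>All jumps are compensated here, not only those in \<open>[-1, 1]\<close>; the difference is a drift.\<close>

definition cgmy_exponent :: "real \<Rightarrow> real \<Rightarrow> real \<Rightarrow> real \<Rightarrow> real \<Rightarrow> complex" where
  "cgmy_exponent C G M Y v =
     (CLBINT y. of_real (cgmy_density C G M Y y) * (iexp (v * y) - 1 - \<i> * of_real (v * y)))"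

text \<open>Tempering only decreases the density, so the bound is free of \<open>G\<close> and
  \<open>M\<close>. It therefore dominates uniformly along \<open>h * G\<close>,
  \<open>h * M\<close> as \<open>h\<close> tends to 0, and at the limit as well.\<close>

lemma norm_cgmy_integrand_le:
  fixes v y :: real
  assumes "C \<ge> 0" "G \<ge> 0" "M \<ge> 0"
  shows "norm (of_real (cgmy_density C G M Y y) * (iexp (v * y) - 1 - \<i> * of_real (v * y)))
     \<le> C * (2 * (\<bar>v\<bar> + v\<^sup>2) * (if \<bar>y\<bar> \<le> 1 then \<bar>y\<bar> powr (1 - Y) else \<bar>y\<bar> powr (- Y)))"
proof -
  have "norm (of_real (cgmy_density C G M Y y) * (iexp (v * y) - 1 - \<i> * of_real (v * y)))
     = cgmy_density C G M Y y * norm (iexp (v * y) - 1 - \<i> * of_real (v * y))"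
    using cgmy_density_nonneg[OF assms(1), of G M Y y] by (simp add: norm_mult)
  also have "\<dots> \<le> C * \<bar>y\<bar> powr (- 1 - Y) * norm (iexp (v * y) - 1 - \<i> * of_real (v * y))"
    by (intro mult_right_mono cgmy_density_le assms) auto
  also have "\<dots> = C * (norm (iexp (v * y) - 1 - \<i> * of_real (v * y)) * \<bar>y\<bar> powr (- 1 - Y))"
    by simp
  also have "\<dots> \<le> C * (2 * (\<bar>v\<bar> + v\<^sup>2) * (if \<bar>y\<bar> \<le> 1 then \<bar>y\<bar> powr (1 - Y) else \<bar>y\<bar> powr (- Y)))"
    by (intro mult_left_mono norm_iexp_compensated_le assms)
  finally show ?thesis .
qed

text \<open>Y < 2 gives 1 - Y > -1 at the origin, and Y > 1 gives - Y < -1 in the tails.\<close>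

lemma integrable_compensator_bound:
  fixes Y :: real
  assumes "1 < Y" "Y < 2"
  shows "integrable lborel (\<lambda>y. C * (c * (if \<bar>y\<bar> \<le> 1 then \<bar>y\<bar> powr (1 - Y) else \<bar>y\<bar> powr (- Y))))"
  using assms by (intro integrable_mult_right integrable_powr_split) auto

lemma integrable_cgmy_exponent:
  assumes "C \<ge> 0" "G \<ge> 0" "M \<ge> 0" "1 < Y" "Y < 2"
  shows "complex_integrable lborel
    (\<lambda>y. of_real (cgmy_density C G M Y y) * (iexp (v * y) - 1 - \<i> * of_real (v * y)))"
proof (rule Bochner_Integration.integrable_bound[OF integrable_compensator_bound[OF assms(4,5)]])
  show "AE y in lborel. norm (of_real (cgmy_density C G M Y y) * (iexp (v * y) - 1 - \<i> * of_real (v * y)))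
      \<le> norm (C * (2 * (\<bar>v\<bar> + v\<^sup>2) * (if \<bar>y\<bar> \<le> 1 then \<bar>y\<bar> powr (1 - Y) else \<bar>y\<bar> powr (- Y))))"
    unfolding real_norm_def
    by (intro always_eventually allI order_trans[OF norm_cgmy_integrand_le[OF assms(1-3)]] abs_ge_self)
qed auto

text \<open>Serves to control the imaginary part near 0; \<open>K\<close> is chosen before
  \<open>G\<close> and \<open>M\<close>, hence is uniform under rescaling.\<close>

lemma norm_cgmy_exponent_le:
  fixes Y :: real
  assumes "C \<ge> 0" "1 < Y" "Y < 2"
  obtains K where "K \<ge> 0" "\<And>G M v. G \<ge> 0 \<Longrightarrow> M \<ge> 0 \<Longrightarrow> norm (cgmy_exponent C G M Y v) \<le> K * (\<bar>v\<bar> + v\<^sup>2)"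
proof
  define g where "g y = (if \<bar>y\<bar> \<le> 1 then \<bar>y\<bar> powr (1 - Y) else \<bar>y\<bar> powr (- Y))" for y
  show "2 * C * (\<integral>y. g y \<partial>lborel) \<ge> 0"
    using assms by (intro mult_nonneg_nonneg integral_nonneg_AE) (auto simp: g_def)
  fix G M v :: real assume GM: "G \<ge> 0" "M \<ge> 0"
  have "norm (cgmy_exponent C G M Y v) \<le> (\<integral>y. C * (2 * (\<bar>v\<bar> + v\<^sup>2) * g y) \<partial>lborel)"
    unfolding cgmy_exponent_def
  proof (rule Bochner_Integration.integral_norm_bound_integral)
    show "integrable lborel (\<lambda>y. C * (2 * (\<bar>v\<bar> + v\<^sup>2) * g y))"
      unfolding g_def by (rule integrable_compensator_bound[OF assms(2,3)])
    show "norm (of_real (cgmy_density C G M Y y) * (iexp (v * y) - 1 - \<i> * of_real (v * y)))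
        \<le> C * (2 * (\<bar>v\<bar> + v\<^sup>2) * g y)" for y
      unfolding g_def by (rule norm_cgmy_integrand_le[OF assms(1) GM])
  qed (rule integrable_cgmy_exponent[OF assms(1) GM assms(2,3)])
  also have "\<dots> = 2 * C * (\<integral>y. g y \<partial>lborel) * (\<bar>v\<bar> + v\<^sup>2)" by simp
  finally show "norm (cgmy_exponent C G M Y v) \<le> \<dots>" .
qed

text \<open>The negative of the real part is the integral of density times 1 - cos (v y), whose
  integrand is nonnegative and at most the untempered one. The power |v|^Y obtained this way is of
  smaller order at 0 than the linear bound on the norm, as the domination requires.\<close>

lemma Re_cgmy_exponent_nonpos:
  assumes "C \<ge> 0" "G \<ge> 0" "M \<ge> 0" "1 < Y" "Y < 2"
  shows "Re (cgmy_exponent C G M Y v) \<le> 0"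
    and "- Re (cgmy_exponent C G M Y v) \<le> C * (\<bar>v\<bar> powr Y * stable_const Y)"
proof -
  have "- Re (cgmy_exponent C G M Y v) = - (\<integral>y. Re (of_real (cgmy_density C G M Y y) * (iexp (v * y) - 1 - \<i> * of_real (v * y))) \<partial>lborel)"
    unfolding cgmy_exponent_def using integral_Re[OF integrable_cgmy_exponent[OF assms]] by simp
  also have "\<dots> = (\<integral>y. cgmy_density C G M Y y * (1 - cos (v * y)) \<partial>lborel)"
    unfolding Bochner_Integration.integral_minus[symmetric]
    by (intro Bochner_Integration.integral_cong refl) (simp add: Re_exp algebra_simps)
  finally have eq: "- Re (cgmy_exponent C G M Y v) = \<dots>" .
  have nn: "cgmy_density C G M Y y * (1 - cos (v * y)) \<ge> 0" for y
    using cgmy_density_nonneg[OF assms(1)] by simp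
  have "- Re (cgmy_exponent C G M Y v) \<ge> 0"
    unfolding eq using nn by (intro integral_nonneg_AE) auto
  thus "Re (cgmy_exponent C G M Y v) \<le> 0" by simp
  have int: "integrable lborel (\<lambda>y. cgmy_density C G M Y y * (1 - cos (v * y)))"
  proof -
    have "integrable lborel (\<lambda>y. - Re (of_real (cgmy_density C G M Y y) * (iexp (v * y) - 1 - \<i> * of_real (v * y))))"
      using integrable_cgmy_exponent[OF assms, of v] by (intro Bochner_Integration.integrable_minus integrable_Re)
    thus ?thesis by (simp add: Re_exp algebra_simps)
  qed
  have "ennreal (- Re (cgmy_exponent C G M Y v)) = (\<integral>\<^sup>+y. ennreal (cgmy_density C G M Y y * (1 - cos (v * y))) \<partial>lborel)"
    unfolding eq using int nn by (subst nn_integral_eq_integral) auto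
  also have "\<dots> \<le> (\<integral>\<^sup>+y. ennreal (C * ((1 - cos (v * y)) * \<bar>y\<bar> powr (- 1 - Y))) \<partial>lborel)"
  proof (intro nn_integral_mono ennreal_leI)
    fix y
    show "cgmy_density C G M Y y * (1 - cos (v * y)) \<le> C * ((1 - cos (v * y)) * \<bar>y\<bar> powr (- 1 - Y))"
      using mult_right_mono[OF cgmy_density_le[OF assms(1-3), of Y y], of "1 - cos (v * y)"]
      by (simp add: mult_ac)
  qed
  also have "\<dots> = ennreal C * (\<integral>\<^sup>+y. ennreal ((1 - cos (v * y)) * \<bar>y\<bar> powr (- 1 - Y)) \<partial>lborel)"
    using assms by (intro nn_integral_cmult_real) auto
  also have "\<dots> = ennreal (C * (\<bar>v\<bar> powr Y * stable_const Y))"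
    using assms by (subst nn_integral_one_minus_cos_powr) (simp_all only: ennreal_mult')
  finally show "- Re (cgmy_exponent C G M Y v) \<le> C * (\<bar>v\<bar> powr Y * stable_const Y)"
    using assms by (subst (asm) ennreal_le_iff) (auto simp: less_imp_le[OF stable_const_pos])
qed

text \<open>Without tempering the density is even, so the imaginary part is the integral of an odd
  function, and the real part is the cosine integral already computed.\<close>

lemma cgmy_exponent_stable:
  assumes "C \<ge> 0" "1 < Y" "Y < 2"
  shows "cgmy_exponent C 0 0 Y v = of_real (- (C * (\<bar>v\<bar> powr Y * stable_const Y)))"
proof (rule complex_eqI)
  have k: "cgmy_density C 0 0 Y y = C * \<bar>y\<bar> powr (- 1 - Y)" for y
    by (auto simp: cgmy_density_def)
  note int = integrable_cgmy_exponent[OF assms(1) order_refl order_refl assms(2,3), of v]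
  have "- Re (cgmy_exponent C 0 0 Y v) = - (\<integral>y. Re (of_real (cgmy_density C 0 0 Y y) * (iexp (v * y) - 1 - \<i> * of_real (v * y))) \<partial>lborel)"
    unfolding cgmy_exponent_def using integral_Re[OF int] by simp
  also have "\<dots> = (\<integral>y. C * ((1 - cos (v * y)) * \<bar>y\<bar> powr (- 1 - Y)) \<partial>lborel)"
    unfolding Bochner_Integration.integral_minus[symmetric]
    by (intro Bochner_Integration.integral_cong refl) (simp add: Re_exp k algebra_simps)
  also have "\<dots> = C * (\<integral>y. (1 - cos (v * y)) * \<bar>y\<bar> powr (- 1 - Y) \<partial>lborel)"
    by (rule Bochner_Integration.integral_mult_right_zero)
  also have "(\<integral>y. (1 - cos (v * y)) * \<bar>y\<bar> powr (- 1 - Y) \<partial>lborel) = \<bar>v\<bar> powr Y * stable_const Y"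
    using assms nn_integral_one_minus_cos_powr[of Y v]
    by (subst integral_eq_nn_integral) (auto simp: less_imp_le[OF stable_const_pos])
  finally show "Re (cgmy_exponent C 0 0 Y v) = Re (of_real (- (C * (\<bar>v\<bar> powr Y * stable_const Y))))"
    by simp
  define f where "f y = Im (of_real (cgmy_density C 0 0 Y y) * (iexp (v * y) - 1 - \<i> * of_real (v * y)))" for y
  have "Im (cgmy_exponent C 0 0 Y v) = (\<integral>y. f y \<partial>lborel)"
    unfolding cgmy_exponent_def f_def using integral_Im[OF int] by simp
  \<comment> \<open>Reflection y -> - y: the integral will equal its own negative.\<close>
  moreover have "(\<integral>y. f y \<partial>lborel) = (\<integral>y. f (0 + (- 1) * y) \<partial>lborel)"
    using lborel_integral_real_affine[of "-1" f 0] by simp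
  moreover have "\<dots> = (\<integral>y. - f y \<partial>lborel)"
    by (intro Bochner_Integration.integral_cong refl) (simp add: f_def k Im_exp right_diff_distrib)
  ultimately show "Im (cgmy_exponent C 0 0 Y v) = Im (of_real (- (C * (\<bar>v\<bar> powr Y * stable_const Y))))"
    by simp
qed

section \<open>Scaling and convergence to the stable exponent\<close>

lemma integral_dominated_convergence_at_right_0:
  fixes f :: "'a \<Rightarrow> 'b::{banach, second_countable_topology}" and s :: "real \<Rightarrow> 'a \<Rightarrow> 'b"
  assumes "f \<in> borel_measurable M" "\<And>h. s h \<in> borel_measurable M" "integrable M w"
    and lim: "AE x in M. ((\<lambda>h. s h x) \<longlongrightarrow> f x) (at_right 0)"
    and bound: "\<forall>\<^sub>F h in at_right 0. AE x in M. norm (s h x) \<le> w x"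
  shows "((\<lambda>h. integral\<^sup>L M (s h)) \<longlongrightarrow> integral\<^sup>L M f) (at_right 0)"
  unfolding filterlim_at_right_to_top
proof (rule integral_dominated_convergence_at_top)
  show "AE x in M. ((\<lambda>h. s (inverse h) x) \<longlongrightarrow> f x) at_top"
    using lim unfolding filterlim_at_right_to_top .
  show "\<forall>\<^sub>F h in at_top. AE x in M. norm (s (inverse h) x) \<le> w x"
    using bound unfolding eventually_at_right_to_top .
qed (use assms in auto)

lemma tendsto_cgmy_exponent:
  assumes "C \<ge> 0" "G \<ge> 0" "M \<ge> 0" "1 < Y" "Y < 2"
  shows "((\<lambda>h. cgmy_exponent C (h * G) (h * M) Y v) \<longlongrightarrow> cgmy_exponent C 0 0 Y v) (at_right 0)"
  unfolding cgmy_exponent_def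
proof (rule integral_dominated_convergence_at_right_0[where w="\<lambda>y. C * (2 * (\<bar>v\<bar> + v\<^sup>2) * (if \<bar>y\<bar> \<le> 1 then \<bar>y\<bar> powr (1 - Y) else \<bar>y\<bar> powr (- Y)))"])
  show "\<forall>\<^sub>F h in at_right 0. AE y in lborel. norm (of_real (cgmy_density C (h * G) (h * M) Y y) * (iexp (v * y) - 1 - \<i> * of_real (v * y)))
      \<le> C * (2 * (\<bar>v\<bar> + v\<^sup>2) * (if \<bar>y\<bar> \<le> 1 then \<bar>y\<bar> powr (1 - Y) else \<bar>y\<bar> powr (- Y)))"
    using eventually_at_right_less[of 0]
    by eventually_elim (intro always_eventually allI norm_cgmy_integrand_le, use assms in auto)
  have "cgmy_density C 0 0 Y y = C * \<bar>y\<bar> powr (- 1 - Y)" for y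
    by (auto simp: cgmy_density_def)
  thus "AE y in lborel. ((\<lambda>h. of_real (cgmy_density C (h * G) (h * M) Y y) * (iexp (v * y) - 1 - \<i> * of_real (v * y)))
     \<longlongrightarrow> of_real (cgmy_density C 0 0 Y y) * (iexp (v * y) - 1 - \<i> * of_real (v * y))) (at_right 0)"
    by (intro always_eventually allI tendsto_mult tendsto_const tendsto_of_real) (simp add: tendsto_cgmy_density)
qed (use integrable_compensator_bound[OF assms(4,5)] in auto)

text \<open>Substitute x = h y: the Jacobian \<open>h\<close> and the factor
  \<open>h powr (- 1 - Y)\<close> of the density give \<open>h powr (- Y)\<close>. Compensating
  every jump makes this exact, since v / h times x depends only on v y; a cut-off at jump size 1
  would move to 1 / h.\<close>

lemma cgmy_exponent_scale:
  assumes "h > 0"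
  shows "cgmy_exponent C G M Y (v / h) = of_real (h powr (- Y)) * cgmy_exponent C (h * G) (h * M) Y v"
proof -
  define f :: "real \<Rightarrow> complex" where
    "f x = of_real (cgmy_density C G M Y x) * (iexp (v / h * x) - 1 - \<i> * of_real (v / h * x))" for x
  have "cgmy_exponent C G M Y (v / h) = (CLBINT x. f x)"
    by (simp add: cgmy_exponent_def f_def)
  also have "\<dots> = h *\<^sub>R (CLBINT x. f (0 + h * x))"
    using lborel_integral_real_affine[of h f 0] assms by simp
  also have "(CLBINT x. f (0 + h * x)) = (CLBINT x. of_real (h powr (- 1 - Y)) *
      (of_real (cgmy_density C (h * G) (h * M) Y x) * (iexp (v * x) - 1 - \<i> * of_real (v * x))))"
    using assms by (intro Bochner_Integration.integral_cong refl) (simp add: f_def cgmy_density_mult mult.assoc)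
  also have "\<dots> = of_real (h powr (- 1 - Y)) * cgmy_exponent C (h * G) (h * M) Y v"
    unfolding cgmy_exponent_def by (rule Bochner_Integration.integral_mult_right_zero)
  also have "h *\<^sub>R \<dots> = of_real (h * h powr (- 1 - Y)) * cgmy_exponent C (h * G) (h * M) Y v"
    by (simp add: scaleR_conv_of_real)
  also have "h * h powr (- 1 - Y) = h powr (- Y)"
    using assms by (simp add: powr_mult_base)
  finally show ?thesis .
qed

text \<open>The mean of the jumps outside \<open>{-1..1}\<close> is the drift by which the two
  compensators differ; it is finite because |x|^(-Y) is integrable at infinity for Y > 1.\<close>

lemma integrable_cgmy_large_jumps:
  assumes "C \<ge> 0" "G \<ge> 0" "M \<ge> 0" "1 < Y" "Y < 2"
  shows "integrable lborel (\<lambda>x. cgmy_density C G M Y x * (x * indicator (- {-1..1}) x))"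
proof (rule Bochner_Integration.integrable_bound[OF integrable_compensator_bound[OF assms(4,5), of C 1]], simp)
  have "norm (cgmy_density C G M Y x * (x * indicator (- {-1..1}) x))
       \<le> norm (C * (1 * (if \<bar>x\<bar> \<le> 1 then \<bar>x\<bar> powr (1 - Y) else \<bar>x\<bar> powr (- Y))))" for x
  proof (cases "\<bar>x\<bar> \<le> 1")
    case False
    have "cgmy_density C G M Y x * \<bar>x\<bar> \<le> C * \<bar>x\<bar> powr (- 1 - Y) * \<bar>x\<bar>"
      by (intro mult_right_mono cgmy_density_le assms) auto
    also have "\<dots> = C * \<bar>x\<bar> powr (- Y)"
      using False powr_mult_base[of "\<bar>x\<bar>" "- 1 - Y"] by (simp add: mult_ac)
    finally show ?thesis
      using False assms cgmy_density_nonneg[OF assms(1), of G M Y x] by (simp add: abs_mult indicator_def)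
  qed (auto simp: indicator_def)
  thus "AE x in lborel. norm (cgmy_density C G M Y x * (x * indicator (- {-1..1}) x))
       \<le> norm (C * (1 * (if \<bar>x\<bar> \<le> 1 then \<bar>x\<bar> powr (1 - Y) else \<bar>x\<bar> powr (- Y))))"
    by (intro always_eventually allI)
qed

text \<open>Self-similar scaling \<open>h = t powr (1 / Y)\<close>: the time factor cancels the Jacobian of the jump sizes.\<close>

lemma char_cgmy_scaled:
  assumes "levy_triplet P X b 0 (density lborel (\<lambda>x. ennreal (cgmy_density C G M Y x)))"
    and "C \<ge> 0" "G \<ge> 0" "M \<ge> 0" "1 < Y" "Y < 2"
  obtains d where "\<And>h v. h > 0 \<Longrightarrow> char (distr P borel (X (h powr Y))) (v / h) =
      exp (\<i> * of_real (d * v * h powr (Y - 1)) + cgmy_exponent C (h * G) (h * M) Y v)"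
proof
  define k where "k = cgmy_density C G M Y"
  \<comment> \<open>The integral of \<open>r\<close> converts truncated into full compensation; the
    constant \<open>d\<close> will be \<open>b\<close> plus this integral.\<close>
  define r where "r x = k x * (x * indicator (- {-1..1}) x)" for x :: real
  have k[measurable]: "k \<in> borel_measurable borel" unfolding k_def by measurable
  have r: "integrable lborel r"
    using integrable_cgmy_large_jumps[OF assms(2-6)] by (simp add: r_def[abs_def] k_def)
  have psi: "(CLINT x|density lborel (\<lambda>x. ennreal (k x)). iexp (u * x) - 1 - \<i> * of_real (u * x * indicator {-1..1} x))
      = cgmy_exponent C G M Y u + \<i> * of_real (u * (\<integral>x. r x \<partial>lborel))" for u
  proof -
    have "(CLINT x|density lborel (\<lambda>x. ennreal (k x)). iexp (u * x) - 1 - \<i> * of_real (u * x * indicator {-1..1} x))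
      = (CLBINT x. k x *\<^sub>R (iexp (u * x) - 1 - \<i> * of_real (u * x * indicator {-1..1} x)))"
      by (rule integral_density) (auto simp: k_def cgmy_density_nonneg assms)
    also have "\<dots> = (CLBINT x. of_real (k x) * (iexp (u * x) - 1 - \<i> * of_real (u * x)) + \<i> * of_real u * of_real (r x))"
      by (intro Bochner_Integration.integral_cong refl)
         (auto simp: r_def scaleR_conv_of_real algebra_simps split: split_indicator)
    also have "\<dots> = cgmy_exponent C G M Y u + (CLBINT x. \<i> * of_real u * of_real (r x))"
      unfolding cgmy_exponent_def k_def
      by (intro Bochner_Integration.integral_add integrable_cgmy_exponent assms integrable_mult_right integrable_of_real r)
    also have "(CLBINT x. \<i> * of_real u * of_real (r x)) = \<i> * of_real u * of_real (\<integral>x. r x \<partial>lborel)"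
      by simp
    finally show ?thesis by simp
  qed
  fix h v :: real assume h: "h > 0"
  have p1: "h powr Y * h powr (- Y) = 1" using h by (simp add: powr_add[symmetric])
  \<comment> \<open>The drift scales with the positive exponent Y - 1, which is why it disappears as
    \<open>h\<close> tends to 0.\<close>
  have p2: "h powr Y * (v / h) = v * h powr (Y - 1)" using h by (simp add: powr_diff)
  have *: "of_real p * (\<i> * of_real (b * z) + (of_real q * E + \<i> * of_real (z * R)))
      = of_real (p * q) * E + \<i> * of_real ((b + R) * (p * z))" for p q z R :: real and E :: complex
    by (simp add: algebra_simps)
  have "char (distr P borel (X (h powr Y))) (v / h) =
     exp (of_real (h powr Y) * (\<i> * of_real (b * (v / h)) +
       (of_real (h powr (- Y)) * cgmy_exponent C (h * G) (h * M) Y v + \<i> * of_real ((v / h) * (\<integral>x. r x \<partial>lborel)))))"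
    using assms(1) h unfolding levy_triplet_def k_def[symmetric] psi by (simp add: cgmy_exponent_scale)
  also have "of_real (h powr Y) * (\<i> * of_real (b * (v / h)) +
       (of_real (h powr (- Y)) * cgmy_exponent C (h * G) (h * M) Y v + \<i> * of_real ((v / h) * (\<integral>x. r x \<partial>lborel))))
     = of_real (h powr Y * h powr (- Y)) * cgmy_exponent C (h * G) (h * M) Y v
       + \<i> * of_real ((b + (\<integral>x. r x \<partial>lborel)) * (h powr Y * (v / h)))"
    by (rule *)
  finally show "char (distr P borel (X (h powr Y))) (v / h) =
      exp (\<i> * of_real ((b + (\<integral>x. r x \<partial>lborel)) * v * h powr (Y - 1)) + cgmy_exponent C (h * G) (h * M) Y v)"
    unfolding p1 p2 by (simp add: algebra_simps)
qed

text \<open>With w = a + i b, split 1 - exp a cos b into (1 - exp a) + exp a (1 - cos b). The gain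
  over the bound by the norm of \<open>w\<close> is that the imaginary part, which is only linear
  near the origin, appears squared.\<close>

lemma one_minus_Re_exp_le:
  assumes "Re w \<le> 0"
  shows "1 - Re (exp w) \<le> - Re w + (Im w)\<^sup>2 / 2"
proof -
  have c: "1 - cos (Im w) \<le> (Im w)\<^sup>2 / 2"
  proof -
    have "1 - cos (Im w) = 2 * (sin (Im w / 2))\<^sup>2"
      using cos_double_sin[of "Im w / 2"] by simp
    also have "\<dots> \<le> 2 * (Im w / 2)\<^sup>2"
      using abs_sin_x_le_abs_x[of "Im w / 2"] by (simp only: abs_le_square_iff[symmetric] mult_le_cancel_left) simp
    finally show ?thesis by (simp add: power2_eq_square)
  qed
  have "exp (Re w) * (1 - cos (Im w)) \<le> 1 * (1 - cos (Im w))"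
    using assms by (intro mult_right_mono) auto
  hence 2: "exp (Re w) * (1 - cos (Im w)) \<le> (Im w)\<^sup>2 / 2" using c by simp
  have 1: "1 - exp (Re w) \<le> - Re w" using exp_ge_add_one_self[of "Re w"] by linarith
  have "1 - Re (exp w) = (1 - exp (Re w)) + exp (Re w) * (1 - cos (Im w))"
    by (simp add: Re_exp algebra_simps)
  thus ?thesis using add_mono[OF 1 2] by simp
qed

text \<open>Near 0 use 1 - exp (- z) \<le> z, in the tails 1 - exp (- z) \<le> 1; the constant a + 2
  is large enough for both.\<close>

lemma one_minus_exp_powr_le:
  fixes a v Y :: real
  assumes "a \<ge> 0"
  shows "\<bar>(1 - exp (- (a * \<bar>v\<bar> powr Y))) * \<bar>v\<bar> powr (- 2)\<bar>
      \<le> (a + 2) * (if \<bar>v\<bar> \<le> 1 then \<bar>v\<bar> powr (Y - 2) else \<bar>v\<bar> powr (- 2))"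
proof -
  have "1 - exp (- (a * \<bar>v\<bar> powr Y)) \<le> a * \<bar>v\<bar> powr Y"
    using exp_ge_add_one_self[of "- (a * \<bar>v\<bar> powr Y)"] by simp
  hence "(1 - exp (- (a * \<bar>v\<bar> powr Y))) * \<bar>v\<bar> powr (- 2) \<le> a * \<bar>v\<bar> powr Y * \<bar>v\<bar> powr (- 2)"
    by (rule mult_right_mono) simp
  also have "a * \<bar>v\<bar> powr Y * \<bar>v\<bar> powr (- 2) \<le> (a + 2) * \<bar>v\<bar> powr (Y - 2)"
    unfolding mult.assoc powr_add[symmetric] by (simp add: mult_right_mono)
  finally have 1: "(1 - exp (- (a * \<bar>v\<bar> powr Y))) * \<bar>v\<bar> powr (- 2) \<le> (a + 2) * \<bar>v\<bar> powr (Y - 2)" .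
  have 2: "(1 - exp (- (a * \<bar>v\<bar> powr Y))) * \<bar>v\<bar> powr (- 2) \<le> (a + 2) * \<bar>v\<bar> powr (- 2)"
  proof (rule mult_right_mono)
    show "1 - exp (- (a * \<bar>v\<bar> powr Y)) \<le> a + 2"
      using assms exp_gt_zero[of "- (a * \<bar>v\<bar> powr Y)"] by linarith
  qed simp
  have "(1 - exp (- (a * \<bar>v\<bar> powr Y))) * \<bar>v\<bar> powr (- 2) \<ge> 0"
    using assms by simp
  thus ?thesis using 1 2 by simp
qed

lemma cgmy_char_integral:
  fixes \<phi> :: "real \<Rightarrow> real \<Rightarrow> complex"
  assumes "C \<ge> 0" "G \<ge> 0" "M \<ge> 0" "1 < Y" "Y < 2"
    and phi: "\<And>h v. h > 0 \<Longrightarrow> \<phi> h v = exp (\<i> * of_real (d * v * h powr (Y - 1)) + cgmy_exponent C (h * G) (h * M) Y v)"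
    and meas: "\<And>h. \<phi> h \<in> borel_measurable borel"
  shows "\<And>h. 0 < h \<Longrightarrow> h \<le> 1 \<Longrightarrow> integrable lborel (\<lambda>v. (1 - Re (\<phi> h v)) * \<bar>v\<bar> powr (- 2))"
    and "((\<lambda>h. \<integral>v. (1 - Re (\<phi> h v)) * \<bar>v\<bar> powr (- 2) \<partial>lborel) \<longlongrightarrow>
          (\<integral>v. (1 - exp (- (C * stable_const Y * \<bar>v\<bar> powr Y))) * \<bar>v\<bar> powr (- 2) \<partial>lborel)) (at_right 0)"
proof -
  obtain K where K: "K \<ge> 0" "\<And>G M v. G \<ge> 0 \<Longrightarrow> M \<ge> 0 \<Longrightarrow> norm (cgmy_exponent C G M Y v) \<le> K * (\<bar>v\<bar> + v\<^sup>2)"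
    using norm_cgmy_exponent_le[OF assms(1,4,5)] by blast
  \<comment> \<open>One summand for each bound: the real part; the square of the imaginary part,
    whose slope for \<open>\<bar>v\<bar> \<le> 1\<close> and \<open>h \<le> 1\<close> is at most
    \<open>\<bar>d\<bar> + 2 * K\<close>; and the trivial bound 2 for
    \<open>\<bar>v\<bar> > 1\<close>.\<close>
  define L where "L = C * stable_const Y + (\<bar>d\<bar> + 2 * K)\<^sup>2 + 2"
  have sc: "C * stable_const Y \<ge> 0" using assms stable_const_pos[of Y] by (simp add: less_imp_le)
  define D where "D v = L * (if \<bar>v\<bar> \<le> 1 then \<bar>v\<bar> powr (Y - 2) else \<bar>v\<bar> powr (- 2))" for v :: real
  have D: "integrable lborel D"
    unfolding D_def using assms by (intro integrable_mult_right integrable_powr_split) auto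
  have bound: "norm ((1 - Re (\<phi> h v)) * \<bar>v\<bar> powr (- 2)) \<le> D v" if h: "0 < h" "h \<le> 1" for h v
  proof -
    define w where "w = \<i> * of_real (d * v * h powr (Y - 1)) + cgmy_exponent C (h * G) (h * M) Y v"
    have GM: "h * G \<ge> 0" "h * M \<ge> 0" using h assms by auto
    have w: "Re w \<le> 0" "- Re w \<le> C * (\<bar>v\<bar> powr Y * stable_const Y)"
      using Re_cgmy_exponent_nonpos[OF assms(1) GM assms(4,5), of v] by (simp_all add: w_def)
    have "\<bar>Re (exp w)\<bar> \<le> 1" using abs_Re_le_cmod[of "exp w"] w(1) order_trans[of _ "exp (Re w)" 1] by simp
    hence le2: "1 - Re (exp w) \<le> 2" and nn: "0 \<le> 1 - Re (exp w)" by simp_all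
    have "1 - Re (exp w) \<le> L * \<bar>v\<bar> powr Y" if v: "\<bar>v\<bar> \<le> 1" "v \<noteq> 0"
    proof -
      have "\<bar>Im w\<bar> \<le> \<bar>d * v * h powr (Y - 1)\<bar> + norm (cgmy_exponent C (h * G) (h * M) Y v)"
        using abs_Im_le_cmod[of "cgmy_exponent C (h * G) (h * M) Y v"] by (simp add: w_def)
      also have "\<dots> \<le> \<bar>d\<bar> * \<bar>v\<bar> + 2 * K * \<bar>v\<bar>"
      proof (rule add_mono)
        have "h powr (Y - 1) \<le> 1" using h assms by (simp add: powr_le1)
        thus "\<bar>d * v * h powr (Y - 1)\<bar> \<le> \<bar>d\<bar> * \<bar>v\<bar>"
          by (simp add: abs_mult mult_left_le)
        have "v\<^sup>2 \<le> \<bar>v\<bar>" using v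
          by (metis abs_ge_zero mult_left_le power2_abs power2_eq_square)
        hence "K * (\<bar>v\<bar> + v\<^sup>2) \<le> K * (2 * \<bar>v\<bar>)" using K(1) by (intro mult_left_mono) auto
        thus "norm (cgmy_exponent C (h * G) (h * M) Y v) \<le> 2 * K * \<bar>v\<bar>"
          using K(2)[OF GM, of v] by simp
      qed
      also have "\<dots> = \<bar>(\<bar>d\<bar> + 2 * K) * v\<bar>"
        using K(1) by (simp only: abs_mult) (simp add: distrib_right)
      finally have "\<bar>Im w\<bar> \<le> \<bar>(\<bar>d\<bar> + 2 * K) * v\<bar>" .
      hence "(Im w)\<^sup>2 \<le> (\<bar>d\<bar> + 2 * K)\<^sup>2 * v\<^sup>2"
        by (simp add: abs_le_square_iff power_mult_distrib)
      \<comment> \<open>For \<open>\<bar>v\<bar> \<le> 1\<close> and Y < 2 the squared imaginary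
        part is absorbed into the order of the real part.\<close>
      also have "v\<^sup>2 \<le> \<bar>v\<bar> powr Y"
      proof -
        have "v\<^sup>2 = \<bar>v\<bar> powr 2" using v by simp
        also have "\<dots> \<le> \<bar>v\<bar> powr Y" using v assms by (intro powr_mono') auto
        finally show ?thesis .
      qed
      finally have "(Im w)\<^sup>2 \<le> (\<bar>d\<bar> + 2 * K)\<^sup>2 * \<bar>v\<bar> powr Y" by (simp add: mult_left_mono)
      hence "1 - Re (exp w) \<le> C * (\<bar>v\<bar> powr Y * stable_const Y) + (\<bar>d\<bar> + 2 * K)\<^sup>2 * \<bar>v\<bar> powr Y"
        using one_minus_Re_exp_le[OF w(1)] w(2) zero_le_power2[of "Im w"] by linarith
      also have "\<dots> \<le> L * \<bar>v\<bar> powr Y" by (simp add: L_def algebra_simps)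
      finally show ?thesis .
    qed
    hence "(1 - Re (exp w)) * \<bar>v\<bar> powr (- 2) \<le> D v"
    \<comment> \<open>At \<open>v = 0\<close> both sides vanish because
      \<open>0 powr (- 2) = 0\<close>.\<close>
    proof (cases "v = 0"; cases "\<bar>v\<bar> \<le> 1")
      assume v: "\<bar>v\<bar> \<le> 1" "v \<noteq> 0" and *: "\<bar>v\<bar> \<le> 1 \<Longrightarrow> v \<noteq> 0 \<Longrightarrow> 1 - Re (exp w) \<le> L * \<bar>v\<bar> powr Y"
      have "(1 - Re (exp w)) * \<bar>v\<bar> powr (- 2) \<le> L * \<bar>v\<bar> powr Y * \<bar>v\<bar> powr (- 2)"
        by (intro mult_right_mono *) (use v in auto)
      also have "\<dots> = D v" using v by (simp add: D_def powr_add[symmetric])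
      finally show ?thesis .
    next
      assume v: "v \<noteq> 0" "\<not> \<bar>v\<bar> \<le> 1"
      have "1 - Re (exp w) \<le> L" using le2 sc zero_le_power2[of "\<bar>d\<bar> + 2 * K"] unfolding L_def by linarith
      thus ?thesis using v mult_right_mono[of _ L "\<bar>v\<bar> powr (- 2)"] by (simp add: D_def)
    qed (auto simp: D_def)
    moreover have "\<phi> h v = exp w" using phi[OF h(1)] by (simp add: w_def)
    ultimately show ?thesis using nn by simp
  qed
  show "integrable lborel (\<lambda>v. (1 - Re (\<phi> h v)) * \<bar>v\<bar> powr (- 2))" if "0 < h" "h \<le> 1" for h
  proof (rule Bochner_Integration.integrable_bound[OF D])
    show "AE v in lborel. norm ((1 - Re (\<phi> h v)) * \<bar>v\<bar> powr (- 2)) \<le> norm (D v)"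
      using bound[OF that] by (intro always_eventually allI) (metis abs_ge_self order_trans real_norm_def)
  qed (use meas in measurable)
  show "((\<lambda>h. \<integral>v. (1 - Re (\<phi> h v)) * \<bar>v\<bar> powr (- 2) \<partial>lborel) \<longlongrightarrow>
          (\<integral>v. (1 - exp (- (C * stable_const Y * \<bar>v\<bar> powr Y))) * \<bar>v\<bar> powr (- 2) \<partial>lborel)) (at_right 0)"
  proof (rule integral_dominated_convergence_at_right_0[where w=D])
    have ev: "\<forall>\<^sub>F h in at_right 0. h \<in> {0<..<1::real}"
      by (rule eventually_at_right_real) simp
    thus "\<forall>\<^sub>F h in at_right 0. AE v in lborel. norm ((1 - Re (\<phi> h v)) * \<bar>v\<bar> powr (- 2)) \<le> D v"
      by eventually_elim (intro always_eventually allI bound, auto)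
    have lim: "((\<lambda>h. Re (\<phi> h v)) \<longlongrightarrow> exp (- (C * stable_const Y * \<bar>v\<bar> powr Y))) (at_right 0)" for v
    proof -
      have "((\<lambda>h::real. h powr (Y - 1)) \<longlongrightarrow> 0) (at_right 0)"
        using assms by (intro tendsto_zero_powrI[OF tendsto_ident_at tendsto_const]) (auto simp: eventually_at_right_less less_imp_le eventually_mono[OF eventually_at_right_less])
      hence "((\<lambda>h. Re (exp (\<i> * of_real (d * v * h powr (Y - 1)) + cgmy_exponent C (h * G) (h * M) Y v)))
          \<longlongrightarrow> Re (exp (\<i> * of_real (d * v * 0) + cgmy_exponent C 0 0 Y v))) (at_right 0)"
        by (intro tendsto_intros tendsto_cgmy_exponent assms)
      also have "Re (exp (\<i> * of_real (d * v * 0) + cgmy_exponent C 0 0 Y v)) = exp (- (C * stable_const Y * \<bar>v\<bar> powr Y))"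
        by (simp add: cgmy_exponent_stable assms Re_exp mult_ac)
      finally show ?thesis
        by (rule Lim_transform_eventually) (use phi in \<open>auto intro: eventually_mono[OF ev]\<close>)
    qed
    show "AE v in lborel. ((\<lambda>h. (1 - Re (\<phi> h v)) * \<bar>v\<bar> powr (- 2)) \<longlongrightarrow>
        (1 - exp (- (C * stable_const Y * \<bar>v\<bar> powr Y))) * \<bar>v\<bar> powr (- 2)) (at_right 0)"
      by (intro always_eventually allI tendsto_intros lim)
  qed (use D meas in \<open>measurable\<close>)
qed

text \<open>Substitute u = v / h in the moment formula: the Jacobian 1 / h and the factor h^2 from
  |v / h|^(-2) leave \<open>h\<close>. Finiteness of the rescaled integral yields integrability of
  the identity.\<close>

lemma (in real_distribution) abs_moment_char:
  assumes h: "h > 0" and int: "integrable lborel (\<lambda>v. (1 - Re (char M (v / h))) * \<bar>v\<bar> powr (- 2))"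
  shows "integrable M (\<lambda>x. x)"
    and "(\<integral>x. \<bar>x\<bar> \<partial>M) = h / pi * (\<integral>v. (1 - Re (char M (v / h))) * \<bar>v\<bar> powr (- 2) \<partial>lborel)"
proof -
  have le1: "Re (char M u) \<le> 1" for u
    using cmod_char_le_1[of u] complex_Re_le_cmod[of "char M u"] by linarith
  define I where "I = (\<integral>v. (1 - Re (char M (v / h))) * \<bar>v\<bar> powr (- 2) \<partial>lborel)"
  have I: "I \<ge> 0" unfolding I_def using le1 by (intro integral_nonneg_AE) auto
  have "(\<integral>\<^sup>+u. ennreal ((1 - Re (char M u)) * \<bar>u\<bar> powr (- 2)) \<partial>lborel)
     = ennreal (1 / h) * (\<integral>\<^sup>+v. ennreal ((1 - Re (char M (0 + 1 / h * v))) * \<bar>0 + 1 / h * v\<bar> powr (- 2)) \<partial>lborel)"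
    using h by (subst nn_integral_real_affine[where c="1 / h" and t=0]) auto
  also have "(\<integral>\<^sup>+v. ennreal ((1 - Re (char M (0 + 1 / h * v))) * \<bar>0 + 1 / h * v\<bar> powr (- 2)) \<partial>lborel)
     = ennreal (h\<^sup>2) * (\<integral>\<^sup>+v. ennreal ((1 - Re (char M (v / h))) * \<bar>v\<bar> powr (- 2)) \<partial>lborel)"
  proof (rule nn_integral_cmult_real)
    fix v :: real
    have "\<bar>0 + 1 / h * v\<bar> powr (- 2) = h\<^sup>2 * \<bar>v\<bar> powr (- 2)"
      using h by (simp add: powr_minus power_mult_distrib power_inverse divide_inverse)
    thus "(1 - Re (char M (0 + 1 / h * v))) * \<bar>0 + 1 / h * v\<bar> powr (- 2) = h\<^sup>2 * ((1 - Re (char M (v / h))) * \<bar>v\<bar> powr (- 2))"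
      by simp
  qed auto
  also have "(\<integral>\<^sup>+v. ennreal ((1 - Re (char M (v / h))) * \<bar>v\<bar> powr (- 2)) \<partial>lborel) = ennreal I"
    unfolding I_def by (rule nn_integral_eq_integral[OF int]) (use le1 in auto)
  finally have "(\<integral>\<^sup>+x. ennreal \<bar>x\<bar> \<partial>M) = ennreal (1 / pi) * (ennreal (1 / h) * (ennreal (h\<^sup>2) * ennreal I))"
    by (simp only: nn_integral_abs_char)
  also have "\<dots> = ennreal (h / pi * I)"
    using h I by (simp add: ennreal_mult'[symmetric] power2_eq_square)
  finally have *: "(\<integral>\<^sup>+x. ennreal \<bar>x\<bar> \<partial>M) = ennreal (h / pi * I)" .
  show "integrable M (\<lambda>x. x)"
    by (rule integrableI_bounded) (simp_all add: *)
  show "(\<integral>x. \<bar>x\<bar> \<partial>M) = h / pi * (\<integral>v. (1 - Re (char M (v / h))) * \<bar>v\<bar> powr (- 2) \<partial>lborel)"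
    using h I * by (subst integral_eq_nn_integral) (auto simp: I_def)
qed

section \<open>The Black--Scholes at-the-money price\<close>

text \<open>Up to a constant the distribution function is the integral of a continuous density from
  a fixed base point, so the fundamental theorem of calculus applies.\<close>

lemma std_normal_cdf_deriv:
  "(std_normal_cdf has_real_derivative std_normal_density x) (at x)"
proof -
  interpret N: real_distribution std_normal_distribution by (rule real_dist_normal_dist)
  \<comment> \<open>Any base point left of \<open>x\<close> would do; it makes \<open>x\<close>
    interior to \<open>{a..x + 1}\<close>, and the representation by \<open>F\<close> holds on the
    neighbourhood \<open>{a<..}\<close> of \<open>x\<close>.\<close>
  define a where "a = x - 1"
  define F where "F y = integral {a..y} std_normal_density" for y
  have cont: "continuous_on S std_normal_density" for S
    unfolding std_normal_density_def[abs_def] by (intro continuous_intros) auto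
  have F: "std_normal_cdf y = std_normal_cdf a + F y" if "y > a" for y
  proof -
    have int: "set_integrable lborel {a..y} std_normal_density"
      unfolding set_integrable_def by (rule borel_integrable_compact) (auto intro: cont)
    have "std_normal_cdf y - std_normal_cdf a = measure std_normal_distribution {a<..y}"
      by (rule N.cdf_diff_eq[OF that])
    also have "\<dots> = (\<integral>z. indicator {a<..y} z \<partial>std_normal_distribution)"
      by simp
    also have "\<dots> = (\<integral>z. std_normal_density z *\<^sub>R indicator {a<..y} z \<partial>lborel)"
      by (rule integral_density) auto
    also have "\<dots> = (\<integral>z. indicator {a..y} z *\<^sub>R std_normal_density z \<partial>lborel)"
      using AE_lborel_singleton[of a]
      by (intro integral_cong_AE) (auto elim!: eventually_mono split: split_indicator)
    also have "\<dots> = F y"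
      unfolding F_def using set_borel_integral_eq_integral(2)[OF int] by (simp add: set_lebesgue_integral_def)
    finally show ?thesis by simp
  qed
  have "(F has_real_derivative std_normal_density x) (at x within {a..x + 1})"
    unfolding F_def by (rule integral_has_real_derivative) (auto simp: a_def cont)
  hence "(F has_real_derivative std_normal_density x) (at x)"
    by (subst (asm) at_within_Icc_at) (auto simp: a_def)
  hence "((\<lambda>y. std_normal_cdf a + F y) has_real_derivative std_normal_density x) (at x)"
    by (auto intro!: derivative_eq_intros)
  moreover have "\<forall>\<^sub>F y in nhds x. std_normal_cdf y = std_normal_cdf a + F y"
    by (rule eventually_mono[OF eventually_nhds_in_open[of "{a<..}" x]]) (auto simp: F, simp add: a_def)
  ultimately show ?thesis using DERIV_cong_ev[of x x std_normal_cdf "\<lambda>y. std_normal_cdf a + F y"] by blast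
qed

text \<open>The halves are written as in \<open>atm_implied_vol\<close>, so that the defining
  equation there becomes \<open>atm_price (\<sigma> * sqrt t)\<close> by reassociating
  products.\<close>

definition atm_price :: "real \<Rightarrow> real" where
  "atm_price a = std_normal_cdf (1 / 2 * a) - std_normal_cdf (- (1 / 2) * a)"

lemma atm_price_deriv: "(atm_price has_real_derivative std_normal_density (a / 2)) (at a)"
proof -
  have "(atm_price has_real_derivative
      std_normal_density (1 / 2 * a) * (1 / 2) - std_normal_density (- (1 / 2) * a) * (- (1 / 2))) (at a)"
    unfolding atm_price_def
    by (intro DERIV_diff DERIV_chain2[OF std_normal_cdf_deriv] derivative_eq_intros) auto
  also have "std_normal_density (- (1 / 2) * a) = std_normal_density (1 / 2 * a)"
    by (simp add: std_normal_density_def)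
  finally show ?thesis by simp
qed

lemma atm_price_0 [simp]: "atm_price 0 = 0"
  by (simp add: atm_price_def)

lemma atm_price_strict_mono: "a < b \<Longrightarrow> atm_price a < atm_price b"
  by (rule DERIV_pos_imp_increasing)
     (auto intro!: atm_price_deriv exI[of _ "std_normal_density _"] simp: normal_density_pos)

text \<open>The price is 0 at 0 and tends to 1 at infinity, so the intermediate value theorem
  applies; the solution is not 0 because \<open>c\<close> is positive.\<close>

lemma atm_price_solution:
  assumes "0 < c" "c < 1"
  obtains a where "a > 0" "atm_price a = c"
proof -
  interpret N: real_distribution std_normal_distribution by (rule real_dist_normal_dist)
  have 1: "filterlim (\<lambda>a::real. 1 / 2 * a) at_top at_top"
    by (rule filterlim_tendsto_pos_mult_at_top[OF tendsto_const _ filterlim_ident]) simp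
  have 2: "filterlim (\<lambda>a::real. - (1 / 2) * a) at_bot at_top"
    by (rule filterlim_tendsto_neg_mult_at_bot[OF tendsto_const _ filterlim_ident]) simp
  have "(atm_price \<longlongrightarrow> 1 - 0) at_top"
    unfolding atm_price_def
    by (intro tendsto_diff filterlim_compose[OF N.cdf_lim_at_top_prob 1] filterlim_compose[OF N.cdf_lim_at_bot 2])
  hence "\<forall>\<^sub>F a in at_top. c < atm_price a"
    using assms(2) by (intro order_tendstoD(1)[of _ 1]) auto
  then obtain b where b: "c < atm_price b" "b > 0"
    using eventually_happens[OF eventually_conj[OF _ eventually_gt_at_top[of 0]]] by (metis trivial_limit_at_top_linorder)
  have "\<exists>a\<ge>0. a \<le> b \<and> atm_price a = c"
    using b assms atm_price_deriv
    by (intro IVT) (auto intro: DERIV_isCont)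
  thus thesis using that assms by (metis atm_price_0 less_eq_real_def order_less_irrefl)
qed

lemma atm_implied_vol_eq:
  assumes "t > 0" "a > 0" "atm_price a = 1 / S0 * (\<integral>\<omega>. max (S \<omega> - S0) 0 \<partial>P)"
  shows "atm_implied_vol P S0 S t = a / sqrt t"
proof -
  have eq: "std_normal_cdf (1/2 * \<sigma> * sqrt t) - std_normal_cdf (- (1/2) * \<sigma> * sqrt t) = atm_price (\<sigma> * sqrt t)" for \<sigma>
    by (simp add: atm_price_def mult.assoc)
  show ?thesis
    unfolding atm_implied_vol_def eq assms(3)[symmetric]
  proof (rule the_equality)
    fix \<sigma> assume s: "\<sigma> > 0 \<and> atm_price a = atm_price (\<sigma> * sqrt t)"
    hence "a = \<sigma> * sqrt t" by (metis atm_price_strict_mono less_irrefl not_less_iff_gr_or_eq)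
    thus "\<sigma> = a / sqrt t" using assms by simp
  qed (use assms in auto)
qed

text \<open>Positivity of \<open>m\<close> makes the normalised price eventually lie in the open
  interval (0, 1), where the implied volatility exists. Dividing price over
  \<open>t powr (1 / Y)\<close> by price over total volatility cancels the price; the second
  quotient tends to the slope 1 / sqrt (2 pi) at 0.\<close>

lemma tendsto_atm_implied_vol:
  fixes Y m S0 :: real
  assumes Y: "Y > 0" and m: "m > 0"
    and lim: "((\<lambda>t. 1 / S0 * (\<integral>\<omega>. max (S t \<omega> - S0) 0 \<partial>P) / t powr (1 / Y)) \<longlongrightarrow> m) (at_right 0)"
  shows "((\<lambda>t. atm_implied_vol P S0 (S t) t / t powr (1 / Y - 1 / 2)) \<longlongrightarrow> sqrt (2 * pi) * m) (at_right 0)"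
proof -
  define c where "c t = 1 / S0 * (\<integral>\<omega>. max (S t \<omega> - S0) 0 \<partial>P)" for t
  \<comment> \<open>Total volatility. The choice is meaningful only once \<open>0 < c t < 1\<close>,
    which holds for small \<open>t\<close>.\<close>
  define a where "a t = (SOME a. a > 0 \<and> atm_price a = c t)" for t
  have pos: "\<forall>\<^sub>F t::real in at_right 0. t > 0" by (rule eventually_at_right_less)
  have lim': "((\<lambda>t. c t / t powr (1 / Y)) \<longlongrightarrow> m) (at_right 0)" using lim by (simp add: c_def)
  have "((\<lambda>t::real. t powr (1 / Y)) \<longlongrightarrow> 0) (at_right 0)"
    using Y by (intro tendsto_zero_powrI[OF tendsto_ident_at tendsto_const]) (auto intro: eventually_mono[OF pos])
  from tendsto_mult[OF lim' this]
  have c0: "(c \<longlongrightarrow> 0) (at_right 0)"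
    by (simp, rule_tac Lim_transform_eventually) (auto intro: eventually_mono[OF pos])
  have cpos: "\<forall>\<^sub>F t in at_right 0. c t > 0"
    using order_tendstoD(1)[OF lim' m] pos by eventually_elim (simp add: zero_less_divide_iff)
  have c1: "\<forall>\<^sub>F t in at_right 0. c t < 1"
    using order_tendstoD(2)[OF c0, of 1] by simp
  have a: "\<forall>\<^sub>F t in at_right 0. a t > 0 \<and> atm_price (a t) = c t"
    using cpos c1
  proof eventually_elim
    case (elim t)
    then obtain b where "b > 0 \<and> atm_price b = c t" using atm_price_solution by metis
    thus ?case unfolding a_def by (rule someI)
  qed
  have "filterlim a (at_right 0) (at_right 0)"
    unfolding filterlim_at
  proof (intro conjI)
    show "\<forall>\<^sub>F t in at_right 0. a t \<in> {0<..} \<and> a t \<noteq> 0"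
      using a by eventually_elim auto
    show "(a \<longlongrightarrow> 0) (at_right 0)"
    proof (rule order_tendstoI)
      fix e :: real assume "e > 0"
      \<comment> \<open>Monotonicity inverts the convergence: once the price is below
        \<open>atm_price e\<close>, its argument is below \<open>e\<close>.\<close>
      hence "0 < atm_price e" using atm_price_strict_mono[of 0 e] by simp
      from order_tendstoD(2)[OF c0 this] a show "\<forall>\<^sub>F t in at_right 0. a t < e"
      proof eventually_elim
        case (elim t)
        thus ?case by (metis atm_price_strict_mono not_less_iff_gr_or_eq)
      qed
    next
      fix e :: real assume "e < 0"
      thus "\<forall>\<^sub>F t in at_right 0. e < a t" using a by (auto elim: eventually_mono)
    qed
  qed
  \<comment> \<open>The derivative at 0 read as a difference quotient, with
    \<open>atm_price 0 = 0\<close>.\<close>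
  moreover have "((\<lambda>x. atm_price x / x) \<longlongrightarrow> 1 / sqrt (2 * pi)) (at_right 0)"
    using atm_price_deriv[of 0, unfolded has_field_derivative_iff]
    by (auto intro: tendsto_mono[OF at_le] simp: std_normal_density_def)
  ultimately have "((\<lambda>t. atm_price (a t) / a t) \<longlongrightarrow> 1 / sqrt (2 * pi)) (at_right 0)"
    by (rule filterlim_compose[rotated])
  from tendsto_divide[OF lim' this]
  have "((\<lambda>t. c t / t powr (1 / Y) / (atm_price (a t) / a t)) \<longlongrightarrow> m / (1 / sqrt (2 * pi))) (at_right 0)"
    by simp
  also have "m / (1 / sqrt (2 * pi)) = sqrt (2 * pi) * m" by simp
  finally show ?thesis
  proof (rule Lim_transform_eventually)
    show "\<forall>\<^sub>F t in at_right 0. c t / t powr (1 / Y) / (atm_price (a t) / a t) =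
        atm_implied_vol P S0 (S t) t / t powr (1 / Y - 1 / 2)"
      using pos a cpos
    proof eventually_elim
      case (elim t)
      have "atm_implied_vol P S0 (S t) t = a t / sqrt t"
        using elim by (intro atm_implied_vol_eq) (auto simp: c_def)
      moreover have "t powr (1 / Y - 1 / 2) = t powr (1 / Y) / sqrt t"
        using elim by (simp add: powr_diff powr_half_sqrt)
      ultimately show ?case using elim by simp
    qed
  qed
qed

section \<open>Short-time asymptotics\<close>

lemma (in prob_space) atm_call_abs_moment:
  fixes X :: "'a \<Rightarrow> real"
  assumes X: "integrable M X" and e: "integrable M (\<lambda>\<omega>. exp (X \<omega>))" "expectation (\<lambda>\<omega>. exp (X \<omega>)) = 1"
  shows "\<bar>expectation (\<lambda>\<omega>. max (exp (X \<omega>) - 1) 0) - expectation (\<lambda>\<omega>. \<bar>X \<omega>\<bar>) / 2\<bar> \<le> - expectation X / 2"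
    and "expectation X \<le> 0"
proof -
  have ge: "exp x - 1 - x \<ge> 0" for x :: real
    using exp_ge_add_one_self[of x] by linarith
  have i: "expectation (\<lambda>\<omega>. exp (X \<omega>) - 1 - X \<omega>) = - expectation X"
    using X e prob_space by simp
  have "0 \<le> expectation (\<lambda>\<omega>. exp (X \<omega>) - 1 - X \<omega>)"
    by (rule Bochner_Integration.integral_nonneg) (rule ge)
  thus "expectation X \<le> 0" using i by simp
  \<comment> \<open>The positive part of z is (|z| + z) / 2, and here the second summand has mean
    zero.\<close>
  have "expectation (\<lambda>\<omega>. max (exp (X \<omega>) - 1) 0) = expectation (\<lambda>\<omega>. \<bar>exp (X \<omega>) - 1\<bar> / 2 + (exp (X \<omega>) - 1) / 2)"
    by (intro Bochner_Integration.integral_cong refl) (auto simp: max_def abs_if field_simps)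
  also have "\<dots> = expectation (\<lambda>\<omega>. \<bar>exp (X \<omega>) - 1\<bar>) / 2"
    using e prob_space by simp
  finally have "expectation (\<lambda>\<omega>. max (exp (X \<omega>) - 1) 0) - expectation (\<lambda>\<omega>. \<bar>X \<omega>\<bar>) / 2
      = expectation (\<lambda>\<omega>. \<bar>exp (X \<omega>) - 1\<bar> - \<bar>X \<omega>\<bar>) / 2"
    using X e by (simp add: diff_divide_distrib)
  hence "\<bar>expectation (\<lambda>\<omega>. max (exp (X \<omega>) - 1) 0) - expectation (\<lambda>\<omega>. \<bar>X \<omega>\<bar>) / 2\<bar>
      = \<bar>expectation (\<lambda>\<omega>. \<bar>exp (X \<omega>) - 1\<bar> - \<bar>X \<omega>\<bar>)\<bar> / 2"
    by (simp only: abs_divide abs_numeral)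
  also have "\<bar>expectation (\<lambda>\<omega>. \<bar>exp (X \<omega>) - 1\<bar> - \<bar>X \<omega>\<bar>)\<bar> \<le> expectation (\<lambda>\<omega>. exp (X \<omega>) - 1 - X \<omega>)"
  proof -
    \<comment> \<open>Reverse triangle inequality; exp x - 1 - x is its own absolute value.\<close>
    have le: "\<bar>\<bar>exp x - 1\<bar> - \<bar>x\<bar>\<bar> \<le> exp x - 1 - x" for x :: real
      using ge[of x] by linarith
    have "\<bar>expectation (\<lambda>\<omega>. \<bar>exp (X \<omega>) - 1\<bar> - \<bar>X \<omega>\<bar>)\<bar>
        \<le> expectation (\<lambda>\<omega>. \<bar>\<bar>exp (X \<omega>) - 1\<bar> - \<bar>X \<omega>\<bar>\<bar>)"
      by (rule integral_abs_bound)
    also have "\<dots> \<le> expectation (\<lambda>\<omega>. exp (X \<omega>) - 1 - X \<omega>)"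
      using X e by (intro integral_mono) (auto simp: le)
    finally show ?thesis .
  qed
  finally show "\<bar>expectation (\<lambda>\<omega>. max (exp (X \<omega>) - 1) 0) - expectation (\<lambda>\<omega>. \<bar>X \<omega>\<bar>) / 2\<bar> \<le> - expectation X / 2"
    using i by simp
qed

text \<open>About 1 / t copies of \<open>t\<close> fit into [0, 1]. Additivity and the sign of the
  remaining piece give f 1 \<le> n f t, so a nonpositive f t cannot be much below t f 1. The factor
  2 pays for rounding 1 / t down to an integer. To be applied to the mean of X_t.\<close>

lemma additive_nonpos_ge:
  fixes f :: "real \<Rightarrow> real"
  assumes add: "\<And>s t. 0 \<le> s \<Longrightarrow> s \<le> t \<Longrightarrow> t \<le> 1 \<Longrightarrow> f t - f s = f (t - s)"
    and neg: "\<And>t. 0 \<le> t \<Longrightarrow> t \<le> 1 \<Longrightarrow> f t \<le> 0"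
    and t: "0 < t" "t \<le> 1"
  shows "f t \<ge> 2 * t * f 1"
proof -
  define n where "n = nat \<lfloor>1 / t\<rfloor>"
  have fl: "\<lfloor>1 / t\<rfloor> \<ge> 1" using t by simp
  have n: "real n \<le> 1 / t" "1 / t < real n + 1" "real n \<ge> 1"
    using fl unfolding n_def by linarith+
  have mult: "f (real k * t) = real k * f t" if "real k * t \<le> 1" for k
    using that
  proof (induction k)
    case 0
    show ?case using add[of 0 0] by simp
  next
    case (Suc k)
    have "f (real (Suc k) * t) - f (real k * t) = f (real (Suc k) * t - real k * t)"
      using Suc.prems t by (intro add) (auto simp: mult_right_mono)
    moreover have "real k * t \<le> 1" using Suc.prems t by (simp add: distrib_right)
    ultimately show ?case using Suc.IH by (simp add: distrib_right)
  qed
  have nt: "real n * t \<le> 1" using n(1) t by (simp add: field_simps)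
  \<comment> \<open>The increment over the leftover interval of length \<open>1 - real n * t\<close>
    is a value of \<open>f\<close>, hence nonpositive.\<close>
  have "f 1 - f (real n * t) \<le> 0"
    using add[of "real n * t" 1] neg[of "1 - real n * t"] nt t by simp
  hence "f 1 \<le> real n * f t" using mult[OF nt] by simp
  moreover have "1 \<le> 2 * t * real n"
  proof -
    \<comment> \<open>From 1 / t < n + 1 and n \<ge> 1.\<close>
    have "1 / t \<le> 2 * real n" using n by linarith
    thus ?thesis using t by (simp add: field_simps)
  qed
  ultimately have "2 * t * f 1 \<le> 2 * t * (real n * f t)" using t by (intro mult_left_mono) auto
  also have "\<dots> = (2 * t * real n) * f t" by simp
  also have "\<dots> \<le> 1 * f t"
    using \<open>1 \<le> 2 * t * real n\<close> neg[of t] t by (intro mult_right_mono_neg) auto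
  finally show ?thesis by simp
qed

text \<open>An even characteristic function means, by uniqueness, that the law is invariant under x
  -> - x; positive and negative parts then have the same mean.\<close>

lemma (in real_distribution) positive_part_symmetric:
  assumes sym: "\<And>u. char M (- u) = char M u" and int: "integrable M (\<lambda>x. x)"
  shows "(\<integral>x. max x 0 \<partial>M) = (\<integral>x. \<bar>x\<bar> \<partial>M) / 2"
proof -
  have "char (distr M borel uminus) u = char M u" for u
    using sym[of u] unfolding char_def by (subst integral_distr) auto
  hence d: "distr M borel uminus = M"
    by (intro Levy_uniqueness real_distribution_axioms real_distribution_distr) auto
  have "(\<integral>x. max x 0 \<partial>M) = (\<integral>x. max x 0 \<partial>distr M borel uminus)" by (simp add: d)
  also have "\<dots> = (\<integral>x. max (- x) 0 \<partial>M)" by (subst integral_distr) auto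
  finally have eq: "(\<integral>x. max x 0 \<partial>M) = (\<integral>x. max (- x) 0 \<partial>M)" .
  have "(\<integral>x. \<bar>x\<bar> \<partial>M) = (\<integral>x. max x 0 + max (- x) 0 \<partial>M)"
    by (intro Bochner_Integration.integral_cong refl) auto
  also have "\<dots> = (\<integral>x. max x 0 \<partial>M) + (\<integral>x. max (- x) 0 \<partial>M)"
    using int by (intro Bochner_Integration.integral_add integrable_max) auto
  finally show ?thesis using eq by simp
qed

text \<open>Reflection at - Y gives Gamma (- Y) Gamma (1 + Y) = - pi / sin (pi Y). Splitting the
  sine by the double angle formula produces cos (pi Y / 2), which is negative for 1 < Y < 2, so the
  absolute value absorbs the minus sign.\<close>

lemma stable_const_eq_Gamma:
  assumes "1 < Y" "Y < 2"
  shows "2 * Gamma (- Y) * \<bar>cos (1/2 * Y * pi)\<bar> = stable_const Y"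
proof -
  have s: "sin (pi * Y / 2) > 0" using assms by (intro sin_gt_zero) auto
  have "cos (pi * Y / 2) < 0"
    using assms cos_lt_zero_pi[of "pi * Y / 2"] by simp
  hence c: "\<bar>cos (1/2 * Y * pi)\<bar> = - cos (pi * Y / 2)" "cos (pi * Y / 2) \<noteq> 0"
    by (simp_all add: mult.commute)
  have "Gamma (- Y) * Gamma (1 + Y) = - pi / sin (pi * Y)"
    using Gamma_reflection_real[of "- Y"] by simp
  also have "sin (pi * Y) = 2 * sin (pi * Y / 2) * cos (pi * Y / 2)"
    using sin_double[of "pi * Y / 2"] by simp
  finally have g: "Gamma (- Y) * Gamma (1 + Y) = - pi / (2 * sin (pi * Y / 2) * cos (pi * Y / 2))" .
  have "Gamma (- Y) = - pi / (2 * sin (pi * Y / 2) * cos (pi * Y / 2)) / Gamma (1 + Y)"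
    by (rule eq_divide_imp[OF _ g]) (rule less_imp_neq[THEN not_sym], rule Gamma_real_pos, use assms in simp)
  thus ?thesis using c s by (simp add: stable_const_def)
qed

lemma martingale_expectation:
  assumes "prob_space P" "filtration_on P F" "martingale P F S" "t \<ge> 0"
  shows "(\<integral>\<omega>. S t \<omega> \<partial>P) = (\<integral>\<omega>. S 0 \<omega> \<partial>P)"
proof -
  interpret prob_space P by fact
  have sub: "subalgebra P (F 0)" using assms by (simp add: filtration_on_def)
  interpret finite_measure_subalgebra P "F 0"
    by unfold_locales (rule sub)
  have int: "integrable P (S t)" and ae: "AE \<omega> in P. real_cond_exp P (F 0) (S t) \<omega> = S 0 \<omega>"
    and m: "S 0 \<in> borel_measurable P"
    using assms by (auto simp: martingale_def)
  have "(\<integral>\<omega>. S t \<omega> \<partial>P) = (\<integral>\<omega>. real_cond_exp P (F 0) (S t) \<omega> \<partial>P)"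
    using real_cond_exp_int(2)[OF int] by simp
  also have "\<dots> = (\<integral>\<omega>. S 0 \<omega> \<partial>P)"
    using ae m by (intro integral_cong_AE) auto
  finally show ?thesis .
qed

text \<open>The moment formula with h = 1, halved by symmetry. Positivity ensures that the limit of
  the normalised call price is nonzero, as inverting the Black--Scholes price requires.\<close>

lemma stable_abs_moment:
  assumes "prob_space P" "Z \<in> borel_measurable P" "a > 0" "1 < Y" "Y < 2"
    and char: "\<And>u::real. char (distr P borel Z) u = of_real (exp (- (a * \<bar>u\<bar> powr Y)))"
  shows "(\<integral>\<omega>. max (Z \<omega>) 0 \<partial>P)
           = 1 / (2 * pi) * (\<integral>v. (1 - exp (- (a * \<bar>v\<bar> powr Y))) * \<bar>v\<bar> powr (- 2) \<partial>lborel)"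
    and "(\<integral>\<omega>. max (Z \<omega>) 0 \<partial>P) > 0"
proof -
  interpret prob_space P by fact
  interpret Z: real_distribution "distr P borel Z" using assms(2) by (rule real_distribution_distr)
  define f where "f v = (1 - exp (- (a * \<bar>v\<bar> powr Y))) * \<bar>v\<bar> powr (- 2)" for v :: real
  have f0: "f v \<ge> 0" for v using assms by (simp add: f_def)
  have int: "integrable lborel f"
  proof (rule Bochner_Integration.integrable_bound)
    show "integrable lborel (\<lambda>v. (a + 2) * (if \<bar>v\<bar> \<le> 1 then \<bar>v\<bar> powr (Y - 2) else \<bar>v\<bar> powr (- 2)))"
      using assms by (intro integrable_mult_right integrable_powr_split) auto
    show "AE v in lborel. norm (f v) \<le> norm ((a + 2) * (if \<bar>v\<bar> \<le> 1 then \<bar>v\<bar> powr (Y - 2) else \<bar>v\<bar> powr (- 2)))"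
      unfolding f_def real_norm_def using assms
      by (intro always_eventually allI order_trans[OF one_minus_exp_powr_le] abs_ge_self) simp
  qed (simp add: f_def[abs_def])
  have eq: "(\<lambda>v. (1 - Re (char (distr P borel Z) (v / 1))) * \<bar>v\<bar> powr (- 2)) = f"
    by (simp add: f_def[abs_def] char)
  note mom = Z.abs_moment_char[of 1, unfolded eq, OF zero_less_one int]
  have "(\<integral>\<omega>. max (Z \<omega>) 0 \<partial>P) = (\<integral>x. max x 0 \<partial>distr P borel Z)"
    using assms(2) by (subst integral_distr) auto
  also have "\<dots> = (\<integral>x. \<bar>x\<bar> \<partial>distr P borel Z) / 2"
    by (rule Z.positive_part_symmetric) (simp_all add: char mom)
  also have "\<dots> = 1 / (2 * pi) * (\<integral>v. f v \<partial>lborel)" using mom(2) by simp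
  finally have *: "(\<integral>\<omega>. max (Z \<omega>) 0 \<partial>P) = \<dots>" .
  thus "(\<integral>\<omega>. max (Z \<omega>) 0 \<partial>P)
           = 1 / (2 * pi) * (\<integral>v. (1 - exp (- (a * \<bar>v\<bar> powr Y))) * \<bar>v\<bar> powr (- 2) \<partial>lborel)"
    by (simp add: f_def)
  have "(\<integral>v. f v \<partial>lborel) \<noteq> 0"
  proof
    assume "(\<integral>v. f v \<partial>lborel) = 0"
    hence "AE v in lborel. f v = 0"
      using integral_nonneg_eq_0_iff_AE[OF int] f0 by simp
    hence "AE v in lborel. v = (0::real)"
      by (rule eventually_mono) (use assms in \<open>auto simp: f_def powr_eq_0_iff\<close>)
    \<comment> \<open>The integrand vanishes only at the origin, so any set of positive measure away
      from 0 gives the contradiction.\<close>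
    hence "AE v in lborel. v \<notin> {1..2::real}" by (rule eventually_mono) auto
    hence "emeasure lborel {1..2::real} = 0"
      by (subst (asm) AE_iff_measurable[where N="{1..2}"]) auto
    thus False by simp
  qed
  moreover have "(\<integral>v. f v \<partial>lborel) \<ge> 0" using f0 by (simp add: integral_nonneg_AE)
  ultimately show "(\<integral>\<omega>. max (Z \<omega>) 0 \<partial>P) > 0" unfolding * by simp
qed

text \<open>The error - E X_t / 2 is at most - t E X_1, because the mean is additive in time and
  nonpositive. After division by \<open>t powr (1 / Y)\<close> the power 1 - 1 / Y is positive, so
  the error vanishes.\<close>

lemma levy_process_call_asymptotics:
  fixes X :: "real \<Rightarrow> 'a \<Rightarrow> real"
  assumes P: "prob_space P" and filt: "filtration_on P F" and levy: "levy_process P F X" and Y: "Y > 1"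
    and int: "\<And>t. 0 < t \<Longrightarrow> t \<le> 1 \<Longrightarrow> integrable P (X t)"
    and exp_int: "\<And>t. t \<ge> 0 \<Longrightarrow> integrable P (\<lambda>\<omega>. exp (X t \<omega>))"
    and exp_1: "\<And>t. t \<ge> 0 \<Longrightarrow> (\<integral>\<omega>. exp (X t \<omega>) \<partial>P) = 1"
    and lim: "((\<lambda>t. (\<integral>\<omega>. \<bar>X t \<omega>\<bar> \<partial>P) / t powr (1 / Y)) \<longlongrightarrow> 2 * m) (at_right 0)"
  shows "((\<lambda>t. (\<integral>\<omega>. max (exp (X t \<omega>) - 1) 0 \<partial>P) / t powr (1 / Y)) \<longlongrightarrow> m) (at_right 0)"
proof -
  interpret prob_space P by fact
  have meas[measurable]: "X t \<in> borel_measurable P" if "t \<ge> 0" for t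
    using levy filt that measurable_from_subalg[of P "F t" "X t" borel]
    by (auto simp: levy_process_def filtration_on_def)
  have int': "integrable P (X t)" if "0 \<le> t" "t \<le> 1" for t
  proof (cases "t = 0")
    case True
    have "AE \<omega> in P. X 0 \<omega> = 0" using levy by (simp add: levy_process_def)
    hence "integrable P (X 0) \<longleftrightarrow> integrable P (\<lambda>_. 0 :: real)"
      using meas[of 0] by (intro integrable_cong_AE) auto
    thus ?thesis using True by simp
  qed (use that int in auto)
  define \<mu> where "\<mu> t = expectation (X t)" for t
  have neg: "\<mu> t \<le> 0" if "0 \<le> t" "t \<le> 1" for t
    unfolding \<mu>_def using that by (intro atm_call_abs_moment int' exp_int exp_1) auto
  have add: "\<mu> t - \<mu> s = \<mu> (t - s)" if st: "0 \<le> s" "s \<le> t" "t \<le> 1" for s t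
  proof -
    \<comment> \<open>Additivity of the mean rests on stationarity of the increments.\<close>
    have d: "distr P borel (\<lambda>\<omega>. X t \<omega> - X s \<omega>) = distr P borel (X (t - s))"
      using levy st by (simp add: levy_process_def)
    have "\<mu> t - \<mu> s = expectation (\<lambda>\<omega>. X t \<omega> - X s \<omega>)"
      unfolding \<mu>_def using st by (intro Bochner_Integration.integral_diff[symmetric] int') auto
    also have "\<dots> = (\<integral>x. x \<partial>distr P borel (\<lambda>\<omega>. X t \<omega> - X s \<omega>))"
      using st by (intro integral_distr[symmetric]) (auto intro!: borel_measurable_diff meas)
    also have "\<dots> = \<mu> (t - s)"
      unfolding d \<mu>_def using st by (intro integral_distr) (auto intro!: meas)
    finally show ?thesis .
  qed
  have ev: "\<forall>\<^sub>F t in at_right 0. t \<in> {0<..<1::real}"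
    by (rule eventually_at_right_real) simp
  have "((\<lambda>t. expectation (\<lambda>\<omega>. max (exp (X t \<omega>) - 1) 0) / t powr (1 / Y)
          - expectation (\<lambda>\<omega>. \<bar>X t \<omega>\<bar>) / t powr (1 / Y) / 2) \<longlongrightarrow> 0) (at_right 0)"
  proof (rule Lim_null_comparison)
    show "\<forall>\<^sub>F t in at_right 0. norm (expectation (\<lambda>\<omega>. max (exp (X t \<omega>) - 1) 0) / t powr (1 / Y)
          - expectation (\<lambda>\<omega>. \<bar>X t \<omega>\<bar>) / t powr (1 / Y) / 2) \<le> - \<mu> 1 * t powr (1 - 1 / Y)"
      using ev
    proof eventually_elim
      case (elim t)
      hence t: "0 < t" "t \<le> 1" by auto
      have "\<bar>expectation (\<lambda>\<omega>. max (exp (X t \<omega>) - 1) 0) - expectation (\<lambda>\<omega>. \<bar>X t \<omega>\<bar>) / 2\<bar> \<le> - \<mu> t / 2"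
        unfolding \<mu>_def using t by (intro atm_call_abs_moment int' exp_int exp_1) auto
      \<comment> \<open>The factor 2 lost by rounding cancels the 1 / 2 of the error bound.\<close>
      also have "\<dots> \<le> - \<mu> 1 * t"
        using additive_nonpos_ge[of \<mu> t, OF add neg t] by (simp add: mult_ac)
      finally have "\<bar>expectation (\<lambda>\<omega>. max (exp (X t \<omega>) - 1) 0) - expectation (\<lambda>\<omega>. \<bar>X t \<omega>\<bar>) / 2\<bar> / t powr (1 / Y)
          \<le> - \<mu> 1 * t / t powr (1 / Y)" using t by (intro divide_right_mono) auto
      also have "- \<mu> 1 * t / t powr (1 / Y) = - \<mu> 1 * t powr (1 - 1 / Y)" using t by (simp add: powr_diff)
      finally have "\<bar>(expectation (\<lambda>\<omega>. max (exp (X t \<omega>) - 1) 0) - expectation (\<lambda>\<omega>. \<bar>X t \<omega>\<bar>) / 2) / t powr (1 / Y)\<bar>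
          \<le> - \<mu> 1 * t powr (1 - 1 / Y)" by (simp add: abs_divide)
      thus ?case by (simp add: diff_divide_distrib mult.commute)
    qed
    have "((\<lambda>t::real. t powr (1 - 1 / Y)) \<longlongrightarrow> 0) (at_right 0)"
      using Y by (intro tendsto_zero_powrI[OF tendsto_ident_at tendsto_const]) (auto intro: eventually_mono[OF ev])
    from tendsto_mult_right_zero[OF this]
    show "((\<lambda>t. - \<mu> 1 * t powr (1 - 1 / Y)) \<longlongrightarrow> 0) (at_right 0)" .
  qed
  from tendsto_add[OF this tendsto_divide[OF lim tendsto_const[of 2]]] show ?thesis by simp
qed

theorem proposition4p4:
  fixes P :: "'a measure" and F :: "real \<Rightarrow> 'a measure" and X :: "real \<Rightarrow> 'a \<Rightarrow> real"
    and Pstar :: "'b measure" and Z :: "'b \<Rightarrow> real"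
    and C G M Y S0 :: real
  assumes "prob_space P" and "filtration_on P F"
    and "C > 0" and "G > 0" and "M > 1" and "1 < Y" and "Y < 2" and "S0 > 0"
    and "cgmy_process P F X C G M Y"
    and "martingale P F (\<lambda>t \<omega>. S0 * exp (X t \<omega>))"
    and "prob_space Pstar" and "Z \<in> borel_measurable Pstar"
    and "\<And>u::real. char (distr Pstar borel Z) u =
           of_real (exp (- 2 * C * Gamma (- Y) * \<bar>cos (1/2 * Y * pi)\<bar> * \<bar>u\<bar> powr Y))"
  shows "((\<lambda>t. atm_implied_vol P S0 (\<lambda>\<omega>. S0 * exp (X t \<omega>)) t / t powr (1 / Y - 1 / 2))
           \<longlongrightarrow> sqrt (2 * pi) * (\<integral>\<omega>. max (Z \<omega>) 0 \<partial>Pstar)) (at_right 0)"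
proof -
  interpret prob_space P by fact
  have levy: "levy_process P F X" using assms(9) by (simp add: cgmy_process_def)
  obtain b where trip: "levy_triplet P X b 0 (density lborel (\<lambda>x. ennreal (cgmy_density C G M Y x)))"
    using assms(9) by (auto simp: cgmy_process_def)
  have pos: "C \<ge> 0" "G \<ge> 0" "M \<ge> 0" using assms(3-5) by auto
  have meas: "X t \<in> borel_measurable P" if "t \<ge> 0" for t
    using levy assms(2) that measurable_from_subalg[of P "F t" "X t" borel]
    by (auto simp: levy_process_def filtration_on_def)
  define \<mu> where "\<mu> t = distr P borel (X t)" for t
  have mu: "real_distribution (\<mu> t)" if "t \<ge> 0" for t
    unfolding \<mu>_def using meas[OF that] by (rule real_distribution_distr)
  \<comment> \<open>Time is reparametrised as \<open>h powr Y\<close>, so that the limit is taken in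
    the spatial scale \<open>h\<close>.\<close>
  obtain d where d: "\<And>h v. h > 0 \<Longrightarrow> char (\<mu> (h powr Y)) (v / h) =
      exp (\<i> * of_real (d * v * h powr (Y - 1)) + cgmy_exponent C (h * G) (h * M) Y v)"
    unfolding \<mu>_def using char_cgmy_scaled[OF trip pos assms(6,7)] by blast
  define \<phi> where "\<phi> h v = char (\<mu> (h powr Y)) (v / h)" for h v
  have phim: "\<phi> h \<in> borel_measurable borel" for h
  proof -
    have [measurable]: "char (\<mu> (h powr Y)) \<in> borel_measurable borel"
      by (rule real_distribution.char_measurable[OF mu]) simp
    show ?thesis unfolding \<phi>_def[abs_def] by measurable
  qed
  define J where "J h = (\<integral>v. (1 - Re (\<phi> h v)) * \<bar>v\<bar> powr (- 2) \<partial>lborel)" for h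
  define J0 where "J0 = (\<integral>v. (1 - exp (- (C * stable_const Y * \<bar>v\<bar> powr Y))) * \<bar>v\<bar> powr (- 2) \<partial>lborel)"
  have Jint: "integrable lborel (\<lambda>v. (1 - Re (\<phi> h v)) * \<bar>v\<bar> powr (- 2))" if "0 < h" "h \<le> 1" for h
    by (rule cgmy_char_integral(1)[OF pos assms(6,7) _ phim that]) (simp add: \<phi>_def d)
  have Jlim: "(J \<longlongrightarrow> J0) (at_right 0)"
    unfolding J_def J0_def
    by (rule cgmy_char_integral(2)[OF pos assms(6,7) _ phim]) (simp add: \<phi>_def d)
  have sc: "C * stable_const Y > 0" using assms stable_const_pos[of Y] by simp
  have charZ: "char (distr Pstar borel Z) u = of_real (exp (- (C * stable_const Y * \<bar>u\<bar> powr Y)))" for u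
    unfolding assms(13) stable_const_eq_Gamma[OF assms(6,7), symmetric] by (simp add: mult_ac)
  note Z = stable_abs_moment[OF assms(11,12) sc assms(6,7) charZ, folded J0_def]
  have mom: "integrable P (X t)" "expectation (\<lambda>\<omega>. \<bar>X t \<omega>\<bar>) = t powr (1 / Y) / pi * J (t powr (1 / Y))"
    if t: "0 < t" "t \<le> 1" for t
  proof -
    define h where "h = t powr (1 / Y)"
    have h: "0 < h" "h \<le> 1" "h powr Y = t"
      using t assms(6) by (auto simp: h_def powr_powr powr_le1)
    have m: "X t \<in> borel_measurable P" using meas[of t] t by simp
    interpret \<mu>: real_distribution "\<mu> t" using mu[of t] t by simp
    have eq: "\<phi> h v = char (\<mu> t) (v / h)" for v by (simp add: \<phi>_def h)
    note am = \<mu>.abs_moment_char[OF h(1) Jint[OF h(1,2), unfolded eq]]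
    show "integrable P (X t)"
      using am(1) m unfolding \<mu>_def by (subst (asm) integrable_distr_eq) auto
    have "expectation (\<lambda>\<omega>. \<bar>X t \<omega>\<bar>) = (\<integral>x. \<bar>x\<bar> \<partial>\<mu> t)"
      unfolding \<mu>_def using m by (subst integral_distr) auto
    also have "\<dots> = h / pi * J h" unfolding am(2) J_def eq ..
    finally show "expectation (\<lambda>\<omega>. \<bar>X t \<omega>\<bar>) = t powr (1 / Y) / pi * J (t powr (1 / Y))"
      by (simp add: h_def)
  qed
  have ev: "\<forall>\<^sub>F t in at_right 0. t \<in> {0<..<1::real}"
    by (rule eventually_at_right_real) simp
  have exp_int: "integrable P (\<lambda>\<omega>. exp (X t \<omega>))" if "t \<ge> 0" for t
    using assms(8,10) that by (auto simp: martingale_def)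
  have exp_1: "expectation (\<lambda>\<omega>. exp (X t \<omega>)) = 1" if "t \<ge> 0" for t
  proof -
    have "S0 * expectation (\<lambda>\<omega>. exp (X t \<omega>)) = expectation (\<lambda>\<omega>. S0 * exp (X 0 \<omega>))"
      using martingale_expectation[OF assms(1,2,10) that] by simp
    also have "\<dots> = expectation (\<lambda>\<omega>. S0)"
    proof (rule integral_cong_AE)
      have "AE \<omega> in P. X 0 \<omega> = 0" using levy by (simp add: levy_process_def)
      thus "AE \<omega> in P. S0 * exp (X 0 \<omega>) = S0" by eventually_elim simp
    qed (use meas[of 0] in auto)
    finally show ?thesis using assms(8) prob_space by simp
  qed
  have "((\<lambda>t. expectation (\<lambda>\<omega>. max (exp (X t \<omega>) - 1) 0) / t powr (1 / Y)) \<longlongrightarrow> 1 / (2 * pi) * J0) (at_right 0)"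
  proof (rule levy_process_call_asymptotics[OF assms(1,2) levy assms(6) mom(1) exp_int exp_1])
    have "((\<lambda>t::real. t powr (1 / Y)) \<longlongrightarrow> 0) (at_right 0)"
      using assms(6) by (intro tendsto_zero_powrI[OF tendsto_ident_at tendsto_const]) (auto intro: eventually_mono[OF ev])
    \<comment> \<open>The scale tends to 0 through positive values, so the one-sided limit of
      \<open>J\<close> can be composed with it.\<close>
    hence "filterlim (\<lambda>t::real. t powr (1 / Y)) (at_right 0) (at_right 0)"
      unfolding filterlim_at by (auto intro: eventually_mono[OF ev])
    from filterlim_compose[OF Jlim this]
    have "((\<lambda>t. J (t powr (1 / Y)) / pi) \<longlongrightarrow> J0 / pi) (at_right 0)"
      by (intro tendsto_divide tendsto_const) auto
    moreover have "\<forall>\<^sub>F t in at_right 0. J (t powr (1 / Y)) / pi = expectation (\<lambda>\<omega>. \<bar>X t \<omega>\<bar>) / t powr (1 / Y)"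
      using ev by eventually_elim (simp add: mom(2))
    ultimately show "((\<lambda>t. expectation (\<lambda>\<omega>. \<bar>X t \<omega>\<bar>) / t powr (1 / Y)) \<longlongrightarrow> 2 * (1 / (2 * pi) * J0)) (at_right 0)"
      by (auto intro: Lim_transform_eventually)
  qed auto
  \<comment> \<open>Both sides are the same integral of the stable characteristic function, so the
    constant is identified without computing it.\<close>
  also have "1 / (2 * pi) * J0 = (\<integral>\<omega>. max (Z \<omega>) 0 \<partial>Pstar)" using Z(1) by simp
  also have "(\<lambda>t. expectation (\<lambda>\<omega>. max (exp (X t \<omega>) - 1) 0)) =
      (\<lambda>t. 1 / S0 * expectation (\<lambda>\<omega>. max (S0 * exp (X t \<omega>) - S0) 0))"
  proof
    fix t
    have "expectation (\<lambda>\<omega>. max (S0 * exp (X t \<omega>) - S0) 0) = expectation (\<lambda>\<omega>. S0 * max (exp (X t \<omega>) - 1) 0)"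
      using assms(8) by (intro Bochner_Integration.integral_cong refl) (auto simp: max_def algebra_simps)
    thus "expectation (\<lambda>\<omega>. max (exp (X t \<omega>) - 1) 0) = 1 / S0 * expectation (\<lambda>\<omega>. max (S0 * exp (X t \<omega>) - S0) 0)"
      using assms(8) by simp
  qed
  finally show ?thesis
    using assms(6) Z(2) by (intro tendsto_atm_implied_vol) auto
qed

end
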